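(* Let $n$ and $d\ge 1$ be integers with $2d \mid n$, and let $G$ be a simple, finite, loopless, $n$-vertex, $d$-regular graph. For every integer $q > 2\binom{nd/2}{4}$ we have $$ \mathrm{hom}(G,K_q) \leq \mathrm{hom}(K_{d,d},K_q)^{\frac{n}{2d}}, $$ with equality if and only if $G$ is (isomorphic to) the disjoint union of $n/2d$ copies of $K_{d,d}$.
   Context: For graphs $G$ and $H$, a homomorphism ($H$-coloring) from $G$ to $H$ is a map $f:V(G)\to V(H)$ such that $uv\in E(G)$ implies $f(u)f(v)\in E(H)$; $\mathrm{hom}(G,H)$ denotes the number of such maps. $K_q$ is the complete (loopless) graph on $q$ vertices, so $\mathrm{hom}(G,K_q)$ is the number of proper $q$-colorings of $G$. $K_{d,d}$ is the complete bipartite graph with $d$ vertices in each class. *)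

theory Defs
  imports "Graph_Theory.Graph_Theory" "HOL-Library.FuncSet"
begin

text \<open>
  Finite simple graphs are the \<^locale>\<open>pair_graph\<close>s: the edge set is a symmetric, irreflexive
  relation, so an edge \<open>uv\<close> is stored as both \<open>(u, v)\<close> and \<open>(v, u)\<close>.
\<close>

definition homs :: "'a pair_pre_digraph \<Rightarrow> 'b pair_pre_digraph \<Rightarrow> ('a \<Rightarrow> 'b) set" where
  "homs G H = {f \<in> pverts G \<rightarrow>\<^sub>E pverts H. \<forall>u v. (u, v) \<in> parcs G \<longrightarrow> (f u, f v) \<in> parcs H}"

definition hom_count :: "'a pair_pre_digraph \<Rightarrow> 'b pair_pre_digraph \<Rightarrow> nat" where
  "hom_count G H = card (homs G H)"

text \<open>By symmetry of the edge relation, the out-degree of a vertex is its number of neighbours.\<close>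

definition regular :: "nat \<Rightarrow> 'a pair_pre_digraph \<Rightarrow> bool" where
  "regular d G \<longleftrightarrow> (\<forall>v \<in> pverts G. out_degree (with_proj G) v = d)"

definition complete_graph :: "nat \<Rightarrow> nat pair_pre_digraph" where
  "complete_graph q = \<lparr> pverts = {..<q}, parcs = {(i, j). i < q \<and> j < q \<and> i \<noteq> j} \<rparr>"

definition complete_bipartite_graph :: "nat \<Rightarrow> nat \<Rightarrow> (nat + nat) pair_pre_digraph" where
  "complete_bipartite_graph a b =
    \<lparr> pverts = {..<a} <+> {..<b},
      parcs = Inl ` {..<a} \<times> Inr ` {..<b} \<union> Inr ` {..<b} \<times> Inl ` {..<a} \<rparr>"

definition disjoint_copies :: "nat \<Rightarrow> 'a pair_pre_digraph \<Rightarrow> (nat \<times> 'a) pair_pre_digraph" where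
  "disjoint_copies m H =
    \<lparr> pverts = {..<m} \<times> pverts H,
      parcs = {((i, u), (j, v)) | i j u v. i < m \<and> i = j \<and> (u, v) \<in> parcs H} \<rparr>"

lemma complete_digraph_complete_graph: "K\<^bsub>q\<^esub> (with_proj (complete_graph q))"
  by (auto simp: complete_digraph_pair_def complete_graph_def)

lemma complete_bipartite_digraph_complete_bipartite_graph:
  "K\<^bsub>a,b\<^esub> (with_proj (complete_bipartite_graph a b))"
  unfolding complete_bipartite_digraph_pair_def
proof (intro conjI exI)
  show "card (Inl ` {..<a}) = a" "card (Inr ` {..<b}) = b"
    by (simp_all add: card_image)
qed (auto simp: complete_bipartite_graph_def Plus_def)

lemma pair_graph_disjoint_copies:
  assumes "pair_graph H"
  shows "pair_graph (disjoint_copies m H)"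
proof -
  interpret pair_graph H by fact
  have "parcs (disjoint_copies m H) \<subseteq> ({..<m} \<times> pverts H) \<times> ({..<m} \<times> pverts H)"
    by (auto simp: disjoint_copies_def dest: in_arcsD1 in_arcsD2)
  then have "finite (parcs (disjoint_copies m H))"
    by (rule finite_subset) (simp add: pair_finite_verts)
  then show ?thesis
    by unfold_locales
      (auto simp: disjoint_copies_def symmetric_def pair_finite_verts
        dest: in_arcsD1 in_arcsD2 no_loops' intro!: symI intro: arcs_symmetric)
qed

end

theory Submission
  imports Defs Complex_Main
begin

text \<open>
  Colour the vertices uniformly at random. The number of monochromatic edges is then estimated by the
  Bonferroni inequalities, whose terms sum the probabilities \<open>1 / q ^ rank F\<close> that a set \<open>F\<close> of edges is
  entirely monochromatic. With \<open>m\<close> the number of edges, the partial sums depend only on \<open>m\<close> up to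
  order \<open>1 / q\<^sup>2\<close>, where a triangle lowers the count, and, without triangles, up to order
  \<open>1 / q ^ 3\<close>, where the number of 4-cycles enters positively. An edge of a triangle-free \<open>d\<close>-regular
  graph lies in at most \<open>(d - 1)\<^sup>2\<close> 4-cycles, and equality at every edge says that the
  neighbourhoods of adjacent vertices are completely joined, i.e. that every component is a
  \<open>K\<^bsub>d,d\<^esub>\<close>. The bound on \<open>q\<close> makes this difference dominate the remaining terms.
\<close>

section \<open>Small edge sets without a pendant edge\<close>

text \<open>Probabilities are computed by peeling: an edge of \<open>F\<close> with an endpoint on
  no other edge of \<open>F\<close> contributes an exact factor \<open>1 / q\<close>. So
  \<open>prob F\<close> can differ from \<open>1 / q ^ card F\<close> only if peeling gets stuck at
  a nonempty set without pendant edges, and sets of at most five edges are all that has to be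
  classified. The orders of truncation are dictated by parity: the upper bound for the given graph
  stops at the even order 4, whereas the lower bound for the extremal graph has to include the odd
  order 5. Hence stuck sets of five edges (5-cycles, 4-cycles with a chord) need to be excluded only
  in the extremal graph. If the given graph has a triangle, order 3 suffices for the lower bound.
  Both graphs have integral numbers of 4-cycles, so a strict inequality is a gap of at least 1,
  worth at least \<open>1 / q ^ 3 - 1 / q ^ 4\<close>. After scaling by \<open>q ^ 4\<close> the
  gain is \<open>q - 1\<close>, and the terms that it has to beat stay below
  \<open>2 * (m choose 4)\<close>; this is where the bound on \<open>q\<close> is spent.\<close>

definition monochromatic :: "('a \<Rightarrow> 'b) \<Rightarrow> 'a set \<Rightarrow> bool" where
  "monochromatic f e \<longleftrightarrow> (\<forall>x\<in>e. \<forall>y\<in>e. f x = f y)"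

lemma monochromatic_doubleton [simp]: "monochromatic f {u, v} \<longleftrightarrow> f u = f v"
  by (auto simp: monochromatic_def)

definition leafless :: "'a set set \<Rightarrow> bool" where
  "leafless F \<longleftrightarrow> (\<forall>e\<in>F. \<forall>v\<in>e. \<exists>e'\<in>F. v \<in> e' \<and> e' \<noteq> e)"

definition is_triangle :: "'a set set \<Rightarrow> bool" where
  "is_triangle F \<longleftrightarrow> (\<exists>u v w. u \<noteq> v \<and> v \<noteq> w \<and> u \<noteq> w \<and> F = {{u, v}, {u, w}, {v, w}})"

text \<open>The cycle is w - u - v - x - w, read from its edge uv: \<open>w\<close> is attached to
  \<open>u\<close> and \<open>x\<close> to \<open>v\<close>. The definition of \<open>full\<close>
  and the count of 4-cycles through an edge use the same labels.\<close>

definition is_four_cycle :: "'a set set \<Rightarrow> bool" where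
  "is_four_cycle F \<longleftrightarrow> (\<exists>u v w x. distinct [u, v, w, x] \<and> F = {{u, v}, {u, w}, {v, x}, {w, x}})"

definition subsets_of_size :: "nat \<Rightarrow> 'a set \<Rightarrow> 'a set set" where
  "subsets_of_size j A = {F. F \<subseteq> A \<and> card F = j}"

lemma finite_subsets_of_size: "finite A \<Longrightarrow> finite (subsets_of_size j A)"
  by (simp add: subsets_of_size_def)

lemma card_subsets_of_size: "finite A \<Longrightarrow> card (subsets_of_size j A) = card A choose j"
  by (simp add: subsets_of_size_def n_subsets)

lemma card_triangle: "is_triangle F \<Longrightarrow> card F = 3"
  by (auto simp: is_triangle_def doubleton_eq_iff)

lemma card_four_cycle: "is_four_cycle F \<Longrightarrow> card F = 4"
  by (auto simp: is_four_cycle_def doubleton_eq_iff)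

text \<open>The truncated alternating sum telescopes to \<open>(-1) ^ r\<close> times
  \<open>x - 1\<close> choose \<open>r\<close>, so for positive \<open>x\<close> its sign is the
  parity of \<open>r\<close>. Here \<open>x\<close> stands for the number of monochromatic edges of
  one colouring.\<close>

lemma bonferroni_term:
  fixes x r :: nat
  defines "s \<equiv> (\<Sum>j\<le>r. (-1) ^ j * real (x choose j))"
  shows "even r \<Longrightarrow> of_bool (x = 0) \<le> s" and "odd r \<Longrightarrow> s \<le> of_bool (x = 0)"
proof -
  have s: "s = (-1) ^ r * (real x - 1 gchoose r)"
    unfolding s_def gbinomial_sum_lower_neg[symmetric]
    by (simp add: binomial_gbinomial mult.commute)
  \<comment> \<open>At \<open>x = 0\<close> the real upper index is -1 and the generalised binomial
    is \<open>(-1) ^ r\<close>, which cancels the sign; the natural number \<open>x - 1\<close>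
    would truncate there, hence the separate case.\<close>
  have "s = (if x = 0 then 1 else (-1) ^ r * real (x - 1 choose r))"
  proof (cases x)
    case 0
    then show ?thesis
      using gbinomial_minus[of "1::real" r] by (simp add: s flip: power_mult_distrib binomial_gbinomial)
  next
    case (Suc y)
    then show ?thesis by (simp add: s binomial_gbinomial)
  qed
  then show "even r \<Longrightarrow> of_bool (x = 0) \<le> s" and "odd r \<Longrightarrow> s \<le> of_bool (x = 0)"
    by auto
qed

text \<open>Edges are doubletons so that each one enters the inclusion-exclusion once;
  \<open>parcs\<close> stores it in both directions.\<close>

locale simple_graph =
  fixes V :: "'a set" and E :: "'a set set"
  assumes finite_V: "finite V"
    and edge_cases: "e \<in> E \<Longrightarrow> \<exists>u v. e = {u, v} \<and> u \<noteq> v \<and> u \<in> V \<and> v \<in> V"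
begin

lemma edge_neq: "{u, v} \<in> E \<Longrightarrow> u \<noteq> v"
  using edge_cases[of "{u, v}"] by (auto simp: doubleton_eq_iff)

lemma edge_in_V: "{u, v} \<in> E \<Longrightarrow> u \<in> V" "{u, v} \<in> E \<Longrightarrow> v \<in> V"
  using edge_cases[of "{u, v}"] by (auto simp: doubleton_eq_iff)

lemma finite_E: "finite E"
proof (rule finite_subset)
  show "E \<subseteq> Pow V" using edge_cases by blast
qed (simp add: finite_V)

text \<open>Every walk w - u - v - x has adjacent ends: a local description of the graphs whose
  components are complete bipartite or single vertices. The four vertices may coincide, and this
  matters: with \<open>w = x\<close> the condition would demand a loop, which excludes
  triangles.\<close>

definition full :: bool where
  "full \<longleftrightarrow> (\<forall>u v w x. {u, v} \<in> E \<longrightarrow> {u, w} \<in> E \<longrightarrow> {v, x} \<in> E \<longrightarrow> {w, x} \<in> E)"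

definition triangle_free :: bool where
  "triangle_free \<longleftrightarrow> (\<forall>F\<subseteq>E. \<not> is_triangle F)"

lemma triangle_freeD:
  assumes "triangle_free" "{u, v} \<in> E" "{u, w} \<in> E" "{v, w} \<in> E"
  shows False
  using assms edge_neq[of u v] edge_neq[of u w] edge_neq[of v w]
proof -
  have "is_triangle {{u, v}, {u, w}, {v, w}}"
    unfolding is_triangle_def using assms edge_neq by blast
  with assms show False by (simp add: triangle_free_def)
qed

lemma full_triangle_free: "full \<Longrightarrow> triangle_free"
  unfolding triangle_free_def
proof (intro allI impI notI)
  fix F assume "full" "F \<subseteq> E" "is_triangle F"
  then obtain u v w where "{u, v} \<in> E" "{u, w} \<in> E" "{v, w} \<in> E"
    unfolding is_triangle_def by auto
  with \<open>full\<close> have "{w, w} \<in> E" unfolding full_def by blast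
  then show False using edge_neq by blast
qed

lemma leafless_neighbour:
  assumes "leafless F" "F \<subseteq> E" "{u, v} \<in> F"
  obtains w where "{u, w} \<in> F" "w \<noteq> u" "w \<noteq> v"
proof -
  obtain e where e: "e \<in> F" "u \<in> e" "e \<noteq> {u, v}"
    using assms(1)[unfolded leafless_def, rule_format, OF assms(3), of u] by blast
  with edge_cases[of e] assms(2) obtain w where "e = {u, w}" "w \<noteq> u"
    by (auto simp: insert_commute)
  with e show ?thesis using that by auto
qed

text \<open>An edge uv is prolonged at both ends. \<open>w = x\<close> is left open on purpose: it
  is the triangle, and the three edges are distinct even then.\<close>

lemma leafless_path:
  assumes "leafless F" "F \<subseteq> E" "F \<noteq> {}"
  obtains u v w x where "{u, v} \<in> F" "{u, w} \<in> F" "{v, x} \<in> F"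
    "u \<noteq> v" "u \<noteq> w" "v \<noteq> w" "u \<noteq> x" "v \<noteq> x"
proof -
  obtain e where "e \<in> F" using assms by auto
  with edge_cases[of e] assms obtain u v where uv: "{u, v} \<in> F" "u \<noteq> v" by auto
  obtain w where w: "{u, w} \<in> F" "w \<noteq> u" "w \<noteq> v"
    using leafless_neighbour[OF assms(1,2) uv(1)] by blast
  obtain x where x: "{v, x} \<in> F" "x \<noteq> v" "x \<noteq> u"
    using leafless_neighbour[of F v u] assms(1,2) uv(1) by (auto simp: insert_commute)
  show ?thesis using that[OF uv(1) w(1) x(1)] uv w x by auto
qed

lemma finite_subset_E: "F \<subseteq> E \<Longrightarrow> finite F"
  using finite_E finite_subset by blast

lemma leafless_card_ge_3:
  assumes "leafless F" "F \<subseteq> E" "F \<noteq> {}"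
  shows "card F \<ge> 3"
proof -
  obtain u v w x where *: "{u, v} \<in> F" "{u, w} \<in> F" "{v, x} \<in> F"
    "u \<noteq> v" "u \<noteq> w" "v \<noteq> w" "u \<noteq> x" "v \<noteq> x"
    using leafless_path[OF assms] by metis
  have "card {{u, v}, {u, w}, {v, x}} = 3" using * by (auto simp: doubleton_eq_iff)
  with * card_mono[OF finite_subset_E[OF assms(2)], of "{{u, v}, {u, w}, {v, x}}"] show ?thesis by simp
qed

text \<open>The path already uses up \<open>F\<close>, so the second edge that \<open>w\<close>
  needs can only be the one at \<open>v\<close>, which forces \<open>x = w\<close>.\<close>

lemma leafless_card_3:
  assumes "leafless F" "F \<subseteq> E" "card F = 3"
  shows "is_triangle F"
proof -
  have "F \<noteq> {}" using assms(3) by auto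
  then obtain u v w x where *: "{u, v} \<in> F" "{u, w} \<in> F" "{v, x} \<in> F"
    "u \<noteq> v" "u \<noteq> w" "v \<noteq> w" "u \<noteq> x" "v \<noteq> x"
    using leafless_path[OF assms(1,2)] by metis
  have "card {{u, v}, {u, w}, {v, x}} = 3" using * by (auto simp: doubleton_eq_iff)
  then have F: "F = {{u, v}, {u, w}, {v, x}}"
    using * card_subset_eq[OF finite_subset_E[OF assms(2)], of "{{u, v}, {u, w}, {v, x}}"] assms(3) by simp
  obtain y where y: "{w, y} \<in> F" "y \<noteq> w" "y \<noteq> u"
    using leafless_neighbour[of F w u] assms(1,2) *(2) by (auto simp: insert_commute)
  then have "x = w" using F * by (auto simp: doubleton_eq_iff)
  then show ?thesis using F * unfolding is_triangle_def by blast
qed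

text \<open>Both ends of the path w - u - v - x need a second edge and only one edge
  \<open>g\<close> is left, so \<open>g\<close> contains both \<open>w\<close> and
  \<open>x\<close>.\<close>

lemma leafless_card_4:
  assumes "leafless F" "F \<subseteq> E" "card F = 4" "triangle_free"
  shows "is_four_cycle F"
proof -
  have "F \<noteq> {}" using assms(3) by auto
  then obtain u v w x where *: "{u, v} \<in> F" "{u, w} \<in> F" "{v, x} \<in> F"
    "u \<noteq> v" "u \<noteq> w" "v \<noteq> w" "u \<noteq> x" "v \<noteq> x"
    using leafless_path[OF assms(1,2)] by metis
  have wx: "w \<noteq> x" using triangle_freeD[OF assms(4), of u v w] * assms(2) by auto
  have "card {{u, v}, {u, w}, {v, x}} = 3" using * by (auto simp: doubleton_eq_iff)
  then have "card (F - {{u, v}, {u, w}, {v, x}}) = 1"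
    using * assms(3) finite_subset_E[OF assms(2)] by (subst card_Diff_subset) auto
  then obtain g where g: "F - {{u, v}, {u, w}, {v, x}} = {g}" by (auto simp: card_1_singleton_iff)
  have "insert a A = B" if "B - A = {a}" "A \<subseteq> B" for A B :: "'b set" and a using that by blast
  from this[OF g] have F: "F = insert g {{u, v}, {u, w}, {v, x}}" using * by simp
  have only_g: "e \<notin> {{u, v}, {u, w}, {v, x}} \<Longrightarrow> e = g" if "e \<in> F" for e using that by (simp add: F)
  obtain y where y: "{w, y} \<in> F" "y \<noteq> w" "y \<noteq> u"
    using leafless_neighbour[of F w u] assms(1,2) *(2) by (auto simp: insert_commute)
  have "{w, y} \<notin> {{u, v}, {u, w}, {v, x}}" using * wx y by (simp add: doubleton_eq_iff)
  then have "{w, y} = g" by (rule only_g[OF y(1)])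
    then have wg: "w \<in> g" by blast
  obtain z where z: "{x, z} \<in> F" "z \<noteq> x" "z \<noteq> v"
    using leafless_neighbour[of F x v] assms(1,2) *(3) by (auto simp: insert_commute)
  have "{x, z} \<notin> {{u, v}, {u, w}, {v, x}}" using * wx z by (simp add: doubleton_eq_iff)
  then have "{x, z} = g" by (rule only_g[OF z(1)])
    then have xg: "x \<in> g" by blast
  have "g \<in> E" using F assms(2) by simp
  then have "g = {w, x}" using edge_cases[of g] wg xg wx by auto
  with F have "F = {{u, v}, {u, w}, {v, x}, {w, x}}" by (simp add: insert_commute)
  moreover have "distinct [u, v, w, x]" using * wx by simp
  ultimately show ?thesis unfolding is_four_cycle_def by blast
qed

text \<open>The path is prolonged to y - w - u - v - x. If \<open>y = x\<close>, it is a 4-cycle and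
  the fifth edge is a diagonal, giving a triangle. Otherwise the fifth edge closes a 5-cycle, and
  \<open>full\<close> applied to the walk v - u - w - y adds the chord vy, which cuts off the
  triangle v x y.\<close>

lemma not_leafless_card_5:
  assumes "F \<subseteq> E" "card F = 5" "full"
  shows "\<not> leafless F"
proof
  assume ll: "leafless F"
  note tf = full_triangle_free[OF assms(3)]
  have "F \<noteq> {}" using assms(2) by auto
  then obtain u v w x where *: "{u, v} \<in> F" "{u, w} \<in> F" "{v, x} \<in> F"
    "u \<noteq> v" "u \<noteq> w" "v \<noteq> w" "u \<noteq> x" "v \<noteq> x"
    using leafless_path[OF ll assms(1)] by metis
  have wx: "w \<noteq> x" using triangle_freeD[OF tf, of u v w] * assms(1) by auto
  obtain y where y: "{w, y} \<in> F" "y \<noteq> w" "y \<noteq> u"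
    using leafless_neighbour[of F w u] ll assms(1) *(2) by (auto simp: insert_commute)
  note E = *(1-3)[THEN subsetD[OF assms(1)]] y(1)[THEN subsetD[OF assms(1)]]
  have yv: "y \<noteq> v" using triangle_freeD[OF tf E(1,2)] E(4) by (auto simp: insert_commute)
  let ?P = "{{u, v}, {u, w}, {v, x}, {w, y}}"
  have "card ?P = 4" using * wx y by (auto simp: doubleton_eq_iff)
  then have "card (F - ?P) = 1"
    using * y assms(2) finite_subset_E[OF assms(1)] by (subst card_Diff_subset) auto
  then obtain g where g: "F - ?P = {g}" by (auto simp: card_1_singleton_iff)
  have "insert a A = B" if "B - A = {a}" "A \<subseteq> B" for A B :: "'b set" and a using that by blast
  from this[OF g] have F: "F = insert g ?P" using * y by simp
  have only_g: "e \<notin> ?P \<Longrightarrow> e = g" if "e \<in> F" for e using that by (simp add: F)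
  have gE: "g \<in> E" and gP: "g \<notin> ?P"
    using g F assms(1) by simp (use g in blast)
  show False
  proof (cases "y = x")
    case True
    obtain a b where ab: "g = {a, b}" "a \<noteq> b" using edge_cases[OF gE] by auto
    \<comment> \<open>Each endpoint of \<open>g\<close> lies on another edge of \<open>F\<close>,
      and all other edges belong to the 4-cycle.\<close>
    have "g \<subseteq> {u, v, w, x}"
    proof
      fix c assume "c \<in> g"
      moreover have "g \<in> F" using F by simp
      ultimately obtain e where "e \<in> F" "c \<in> e" "e \<noteq> g" using ll unfolding leafless_def by blast
      then have "e \<in> ?P" using F by simp
      then show "c \<in> {u, v, w, x}" using True \<open>c \<in> e\<close> by auto
    qed
    then have "a \<in> {u, v, w, x}" "b \<in> {u, v, w, x}" using ab by simp_all
    moreover have "{a, b} \<noteq> {u, v}" "{a, b} \<noteq> {u, w}" "{a, b} \<noteq> {v, x}" "{a, b} \<noteq> {w, x}"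
      using gP ab True by simp_all
    ultimately have "g = {u, x} \<or> g = {v, w}" using ab
      by (elim insertE emptyE) (simp_all add: insert_commute)
    then show False
      using triangle_freeD[OF tf, of u x v] triangle_freeD[OF tf, of v w u] E gE
      by (elim disjE) (simp_all add: insert_commute)
  next
    case False
    obtain z where z: "{x, z} \<in> F" "z \<noteq> x" "z \<noteq> v"
      using leafless_neighbour[of F x v] ll assms(1) *(3) by (auto simp: insert_commute)
    have "{x, z} \<notin> ?P" using * wx z y False by (simp add: doubleton_eq_iff)
    then have "{x, z} = g" by (rule only_g[OF z(1)])
    then have xg: "x \<in> g" by blast
    obtain z where z: "{y, z} \<in> F" "z \<noteq> y" "z \<noteq> w"
      using leafless_neighbour[of F y w] ll assms(1) y(1) by (auto simp: insert_commute)
    have "{y, z} \<notin> ?P" using * y yv z False by (simp add: doubleton_eq_iff)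
    then have "{y, z} = g" by (rule only_g[OF z(1)])
    then have yg: "y \<in> g" by blast
    have "g = {x, y}" using edge_cases[OF gE] xg yg False by auto
    moreover have "{v, y} \<in> E"
      using assms(3)[unfolded full_def, rule_format, of u w v y] E by simp
    ultimately show False using triangle_freeD[OF tf, of v x y] E gE by simp
  qed
qed

end

section \<open>Random colourings\<close>

locale coloured_graph = simple_graph V E for V :: "'a set" and E +
  fixes q :: nat
  assumes q_pos: "q > 0"
begin

definition colourings :: "('a \<Rightarrow> nat) set" where
  "colourings = V \<rightarrow>\<^sub>E {..<q}"

definition prob :: "'a set set \<Rightarrow> real" where
  "prob F = card {f \<in> colourings. \<forall>e\<in>F. monochromatic f e} / real q ^ card V"

definition proper_prob :: real where
  "proper_prob = card {f \<in> colourings. \<forall>e\<in>E. \<not> monochromatic f e} / real q ^ card V"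

definition prob_sum :: "nat \<Rightarrow> real" where
  "prob_sum j = (\<Sum>F\<in>subsets_of_size j E. prob F)"

lemma finite_colourings: "finite colourings"
  unfolding colourings_def by (intro finite_PiE finite_V) simp

lemma card_colourings: "card colourings = q ^ card V"
  unfolding colourings_def by (simp add: card_PiE finite_V)

lemma prob_empty: "prob {} = 1"
  using q_pos by (simp add: prob_def card_colourings)

lemma prob_antimono: "F \<subseteq> F' \<Longrightarrow> prob F' \<le> prob F"
  unfolding prob_def
  by (intro divide_right_mono of_nat_mono card_mono) (auto simp: finite_colourings)

text \<open>Double counting of pairs of a colouring \<open>f\<close> and a \<open>j\<close>-set of
  edges that are all monochromatic under \<open>f\<close>; this turns the pointwise inequality into
  one between probabilities.\<close>

lemma bonferroni_sum:
  "(\<Sum>j\<le>r. (-1) ^ j * prob_sum j) =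
   (\<Sum>f\<in>colourings. \<Sum>j\<le>r. (-1) ^ j * real (card {e\<in>E. monochromatic f e} choose j)) / real q ^ card V"
proof -
  have "(\<Sum>f\<in>colourings. real (card {e\<in>E. monochromatic f e} choose j)) = prob_sum j * real q ^ card V" for j
  proof -
    have "(\<Sum>f\<in>colourings. card {e\<in>E. monochromatic f e} choose j) =
      (\<Sum>f\<in>colourings. card {F \<in> subsets_of_size j E. \<forall>e\<in>F. monochromatic f e})"
    proof (rule sum.cong)
      fix f
      have "{F \<in> subsets_of_size j E. \<forall>e\<in>F. monochromatic f e}
        = subsets_of_size j {e\<in>E. monochromatic f e}"
        by (auto simp: subsets_of_size_def)
      then show "card {e\<in>E. monochromatic f e} choose j =
        card {F \<in> subsets_of_size j E. \<forall>e\<in>F. monochromatic f e}"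
        by (simp add: card_subsets_of_size finite_E)
    qed simp
    also have "\<dots> = (\<Sum>F\<in>subsets_of_size j E. card {f \<in> colourings. \<forall>e\<in>F. monochromatic f e})"
      by (rule sum_multicount_gen) (simp_all add: finite_colourings finite_subsets_of_size finite_E)
    finally have "(\<Sum>f\<in>colourings. card {e\<in>E. monochromatic f e} choose j) = \<dots>" .
    from arg_cong[OF this, of real] q_pos show ?thesis
      unfolding prob_sum_def prob_def by (simp flip: sum_divide_distrib)
  qed
  note * = this
  have "(\<Sum>f\<in>colourings. \<Sum>j\<le>r. (-1) ^ j * real (card {e\<in>E. monochromatic f e} choose j))
    = (\<Sum>j\<le>r. (-1) ^ j * prob_sum j) * real q ^ card V"
    by (subst sum.swap) (simp add: * sum_distrib_right mult.assoc flip: sum_distrib_left)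
  then show ?thesis using q_pos by simp
qed

lemma proper_prob_eq:
  "proper_prob = (\<Sum>f\<in>colourings. of_bool (card {e\<in>E. monochromatic f e} = 0)) / real q ^ card V"
proof -
  have "{f \<in> colourings. \<forall>e\<in>E. \<not> monochromatic f e}
    = {f \<in> colourings. card {e\<in>E. monochromatic f e} = 0}"
    by (auto simp: finite_E)
  then show ?thesis
    by (simp add: proper_prob_def finite_colourings Int_def del: card_eq_0_iff)
qed

lemma bonferroni:
  shows "even r \<Longrightarrow> proper_prob \<le> (\<Sum>j\<le>r. (-1) ^ j * prob_sum j)"
    and "odd r \<Longrightarrow> (\<Sum>j\<le>r. (-1) ^ j * prob_sum j) \<le> proper_prob"
  unfolding bonferroni_sum proper_prob_eq
  by (auto intro!: divide_right_mono sum_mono bonferroni_term simp del: card_eq_0_iff of_bool_eq_iff)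

text \<open>\<open>F\<close> puts no condition on the colour of \<open>v\<close>; the new edge
  forces it to be the colour of \<open>u\<close>.\<close>

lemma prob_leaf:
  assumes "u \<in> V" "v \<in> V" "u \<noteq> v" "\<forall>e\<in>F. v \<notin> e"
  shows "prob (insert {u, v} F) = prob F / q"
proof -
  let ?M = "\<lambda>F. {f \<in> colourings. \<forall>e\<in>F. monochromatic f e}"
  have upd: "monochromatic (f(v := c)) e \<longleftrightarrow> monochromatic f e" if "e \<in> F" for f :: "'a \<Rightarrow> nat" and c e
    using assms(4) that by (auto simp: monochromatic_def)
  \<comment> \<open>The inverse remembers the colour of \<open>v\<close> and then overwrites it by
    that of \<open>u\<close>.\<close>
  have "bij_betw (\<lambda>(f, c). f(v := c)) (?M (insert {u, v} F) \<times> {..<q}) (?M F)"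
    by (rule bij_betw_byWitness[where f' = "\<lambda>g. (g(v := g u), g v)"])
      (use assms in \<open>auto simp: colourings_def upd fun_eq_iff PiE_def Pi_def extensional_def\<close>)
  from bij_betw_same_card[OF this] have "card (?M F) = card (?M (insert {u, v} F)) * q"
    by (simp add: card_cartesian_product)
  then show ?thesis using q_pos by (simp add: prob_def)
qed

lemma obtain_leaf:
  assumes "F \<subseteq> E" "\<not> leafless F"
  obtains e where "e \<in> F" "prob F = prob (F - {e}) / q"
proof -
  obtain e v where e: "e \<in> F" "v \<in> e" "\<And>e'. e' \<in> F \<Longrightarrow> v \<in> e' \<Longrightarrow> e' = e"
    using assms(2) unfolding leafless_def by blast
  from e(1) assms(1) edge_cases[of e] obtain a b where ab: "e = {a, b}" "a \<noteq> b" "a \<in> V" "b \<in> V"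
    by blast
  then have "v = a \<or> v = b" using e(2) by simp
  with ab obtain u where u: "e = {u, v}" "u \<in> V" "v \<in> V" "u \<noteq> v"
    by (metis insert_commute)
  have "\<forall>e'\<in>F - {e}. v \<notin> e'" using e(3) by blast
  from prob_leaf[OF u(2,3,4) this] have "prob (insert e (F - {e})) = prob (F - {e}) / q"
    unfolding u(1) .
  moreover have "insert e (F - {e}) = F" using e(1) by blast
  ultimately show ?thesis using that[OF e(1)] by simp
qed

lemma obtain_leaf_card:
  assumes "F \<subseteq> E" "\<not> leafless F" "card F = Suc j"
  obtains F' where "F' \<in> subsets_of_size j E" "F' \<subseteq> F" "prob F = prob F' / q"
proof -
  obtain e where "e \<in> F" "prob F = prob (F - {e}) / q" using obtain_leaf[OF assms(1,2)] .
  moreover from this have "F - {e} \<in> subsets_of_size j E"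
    using assms finite_subset_E[OF assms(1)] by (auto simp: subsets_of_size_def)
  ultimately show ?thesis using that by blast
qed

section \<open>Probabilities of edge sets of size at most five\<close>

lemma prob_0: "F \<in> subsets_of_size 0 E \<Longrightarrow> prob F = 1"
  using prob_empty by (auto simp: subsets_of_size_def dest: finite_subset_E)

lemma prob_1:
  assumes "F \<in> subsets_of_size 1 E"
  shows "prob F = 1 / q"
proof -
  have F: "F \<subseteq> E" "card F = Suc 0" using assms by (auto simp: subsets_of_size_def)
  then have "\<not> leafless F" using leafless_card_ge_3[of F] by (cases "F = {}") auto
  then obtain F' where F': "F' \<in> subsets_of_size 0 E" "F' \<subseteq> F" "prob F = prob F' / q"
    by (rule obtain_leaf_card[OF F(1) _ F(2)])
  then show ?thesis using prob_0 by simp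
qed

lemma prob_2:
  assumes "F \<in> subsets_of_size 2 E"
  shows "prob F = 1 / q ^ 2"
proof -
  have F: "F \<subseteq> E" "card F = Suc 1" using assms by (auto simp: subsets_of_size_def)
  then have "\<not> leafless F" using leafless_card_ge_3[of F] by (cases "F = {}") auto
  then obtain F' where F': "F' \<in> subsets_of_size 1 E" "F' \<subseteq> F" "prob F = prob F' / q"
    by (rule obtain_leaf_card[OF F(1) _ F(2)])
  then show ?thesis using prob_1[of F'] by (simp add: power2_eq_square)
qed

lemma prob_3:
  assumes "F \<in> subsets_of_size 3 E" "\<not> is_triangle F"
  shows "prob F = 1 / q ^ 3"
proof -
  have F: "F \<subseteq> E" "card F = Suc 2" using assms by (auto simp: subsets_of_size_def)
  then have "\<not> leafless F" using leafless_card_3[of F] assms by auto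
  then obtain F' where F': "F' \<in> subsets_of_size 2 E" "F' \<subseteq> F" "prob F = prob F' / q"
    by (rule obtain_leaf_card[OF F(1) _ F(2)])
  then show ?thesis using prob_2[of F'] by (simp add: eval_nat_numeral)
qed

lemma prob_triangle:
  assumes "F \<subseteq> E" "is_triangle F"
  shows "prob F = 1 / q ^ 2"
proof -
  obtain u v w where F: "u \<noteq> v" "v \<noteq> w" "u \<noteq> w" "F = {{u, v}, {u, w}, {v, w}}"
    using assms(2) unfolding is_triangle_def by blast
  have "prob F = prob {{u, v}, {u, w}}"
    unfolding prob_def F(4) by (intro arg_cong2[of _ _ _ _ "(/)"] arg_cong[of _ _ card] arg_cong[of _ _ real]) auto
  also have "{{u, v}, {u, w}} \<in> subsets_of_size 2 E"
    using F assms by (auto simp: subsets_of_size_def doubleton_eq_iff)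
  note prob_2[OF this]
  finally show ?thesis .
qed

text \<open>Three edges of the cycle form a path through all its vertices, so the fourth is
  monochromatic automatically.\<close>

lemma prob_four_cycle:
  assumes "F \<subseteq> E" "is_four_cycle F" "triangle_free"
  shows "prob F = 1 / q ^ 3"
proof -
  obtain u v w x where F: "distinct [u, v, w, x]" "F = {{u, v}, {u, w}, {v, x}, {w, x}}"
    using assms(2) unfolding is_four_cycle_def by blast
  have "prob F = prob {{u, v}, {u, w}, {v, x}}"
    unfolding prob_def F(2) by (intro arg_cong2[of _ _ _ _ "(/)"] arg_cong[of _ _ card] arg_cong[of _ _ real]) auto
  also have "{{u, v}, {u, w}, {v, x}} \<in> subsets_of_size 3 E"
    using F assms by (simp add: subsets_of_size_def doubleton_eq_iff)
  from prob_3[OF this] have "prob {{u, v}, {u, w}, {v, x}} = 1 / q ^ 3"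
    using assms(3) F assms(1) unfolding triangle_free_def by simp
  finally show ?thesis .
qed

text \<open>Valid with triangles present. A triangle costs only two factors \<open>1 / q\<close>,
  but the fourth edge then supplies a third; without a triangle any three of the edges
  suffice.\<close>

lemma prob_4_le:
  assumes "F \<in> subsets_of_size 4 E"
  shows "prob F \<le> 1 / q ^ 3"
proof (cases "\<exists>T\<subseteq>F. is_triangle T")
  case True
  then obtain T where T: "T \<subseteq> F" "is_triangle T" by auto
  have F: "F \<subseteq> E" "card F = 4" using assms by (auto simp: subsets_of_size_def)
  obtain u v w where uvw: "u \<noteq> v" "v \<noteq> w" "u \<noteq> w" "T = {{u, v}, {u, w}, {v, w}}"
    using T(2) unfolding is_triangle_def by blast
  have "card (F - T) = 1"
    using F T card_triangle[of T] finite_subset_E[of F] by (subst card_Diff_subset) (auto intro: finite_subset)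
  then obtain e where e: "F - T = {e}" by (auto simp: card_1_singleton_iff)
  then have eF: "e \<in> F" "e \<notin> T" "F - {e} = T" using T by blast+
  obtain a b where ab: "e = {a, b}" "a \<noteq> b" "a \<in> V" "b \<in> V" using eF F edge_cases[of e] by blast
  have key: "prob F = prob T / q" if "b \<notin> {u, v, w}" "e = {a, b}" "a \<in> V" "b \<in> V" "a \<noteq> b" for a b
  proof -
    have "prob (insert {a, b} T) = prob T / q"
      using that uvw by (intro prob_leaf) auto
    moreover have "insert {a, b} T = F" using eF that by blast
    ultimately show ?thesis by simp
  qed
  \<comment> \<open>\<open>T\<close> contains all pairs of its three vertices, so an edge outside
    \<open>T\<close> leaves this vertex set and is pendant at the end outside.\<close>
  have "a \<notin> {u, v, w} \<or> b \<notin> {u, v, w}"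
  proof (rule ccontr)
    assume "\<not> ?thesis"
    then have "e \<in> T" using ab uvw by (auto simp: insert_commute)
    with eF show False by simp
  qed
  then have "prob F = prob T / q"
    using key[of b a] key[of a b] ab by (metis insert_commute)
  also have "prob T = 1 / q ^ 2" using F T by (intro prob_triangle) auto
  finally show ?thesis by (simp add: eval_nat_numeral)
next
  case False
  have F: "F \<subseteq> E" "card F = 4" using assms by (auto simp: subsets_of_size_def)
  have "3 \<le> card F" using F by simp
  then obtain T where "T \<subseteq> F" "card T = 3" by (rule obtain_subset_with_card_n)
  then have "prob T = 1 / q ^ 3"
    using F False by (intro prob_3) (auto simp: subsets_of_size_def)
  with prob_antimono[OF \<open>T \<subseteq> F\<close>] show ?thesis by simp
qed

lemma prob_4:
  assumes "F \<in> subsets_of_size 4 E" "triangle_free" "\<not> is_four_cycle F"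
  shows "prob F = 1 / q ^ 4"
proof -
  have F: "F \<subseteq> E" "card F = Suc 3" using assms by (auto simp: subsets_of_size_def)
  then have "\<not> leafless F" using leafless_card_4[of F] assms by auto
  then obtain F' where F': "F' \<in> subsets_of_size 3 E" "F' \<subseteq> F" "prob F = prob F' / q"
    by (rule obtain_leaf_card[OF F(1) _ F(2)])
  moreover have "\<not> is_triangle F'" using F' assms by (auto simp: triangle_free_def subsets_of_size_def)
  ultimately show ?thesis using prob_3[of F'] by (simp add: eval_nat_numeral)
qed

text \<open>In a full graph one edge can always be peeled off, so the bounds for four edges gain a
  factor \<open>1 / q\<close>.\<close>

lemma prob_5_le:
  assumes "F \<in> subsets_of_size 5 E" "full"
  shows "prob F \<le> 1 / q ^ 4"
    and "(\<And>C. C \<subseteq> F \<Longrightarrow> \<not> is_four_cycle C) \<Longrightarrow> prob F = 1 / q ^ 5"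
proof -
  have F: "F \<subseteq> E" "card F = Suc 4" using assms by (auto simp: subsets_of_size_def)
  then have "\<not> leafless F" using not_leafless_card_5[of F] assms by auto
  then obtain F' where F': "F' \<in> subsets_of_size 4 E" "F' \<subseteq> F" "prob F = prob F' / q"
    by (rule obtain_leaf_card[OF F(1) _ F(2)])
  show "prob F \<le> 1 / q ^ 4"
    using divide_right_mono[OF prob_4_le[OF F'(1)], of q] F'(3) by (simp add: eval_nat_numeral mult.commute mult.left_commute)
  show "prob F = 1 / q ^ 5" if "\<And>C. C \<subseteq> F \<Longrightarrow> \<not> is_four_cycle C"
    using prob_4[OF F'(1) full_triangle_free[OF assms(2)]] that F' by (simp add: eval_nat_numeral)
qed

end

section \<open>Counting 4-cycles\<close>

text \<open>Any edge can play the role of uv by symmetry; the eight cases are the four edges with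
  two orientations each.\<close>

lemma is_four_cycle_through:
  assumes "is_four_cycle C" "{u, v} \<in> C"
  obtains w x where "distinct [u, v, w, x]" "C = {{u, v}, {u, w}, {v, x}, {w, x}}"
proof -
  obtain a b c e where C: "distinct [a, b, c, e]" "C = {{a, b}, {a, c}, {b, e}, {c, e}}"
    using assms(1) unfolding is_four_cycle_def by blast
  consider "u = a" "v = b" | "u = b" "v = a" | "u = a" "v = c" | "u = c" "v = a"
    | "u = b" "v = e" | "u = e" "v = b" | "u = c" "v = e" | "u = e" "v = c"
    using assms(2) unfolding C(2) insert_iff doubleton_eq_iff empty_iff by blast
  then show ?thesis
  proof cases
    case 1 show ?thesis by (rule that[of c e]) (use C 1 in \<open>auto simp: insert_commute\<close>)
  next
    case 2 show ?thesis by (rule that[of e c]) (use C 2 in \<open>auto simp: insert_commute\<close>)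
  next
    case 3 show ?thesis by (rule that[of b e]) (use C 3 in \<open>auto simp: insert_commute\<close>)
  next
    case 4 show ?thesis by (rule that[of e b]) (use C 4 in \<open>auto simp: insert_commute\<close>)
  next
    case 5 show ?thesis by (rule that[of a c]) (use C 5 in \<open>auto simp: insert_commute\<close>)
  next
    case 6 show ?thesis by (rule that[of c a]) (use C 6 in \<open>auto simp: insert_commute\<close>)
  next
    case 7 show ?thesis by (rule that[of a b]) (use C 7 in \<open>auto simp: insert_commute\<close>)
  next
    case 8 show ?thesis by (rule that[of b a]) (use C 8 in \<open>auto simp: insert_commute\<close>)
  qed
qed

context simple_graph
begin

definition neighbours :: "'a \<Rightarrow> 'a set" where
  "neighbours v = {u. {v, u} \<in> E}"

definition is_regular :: "nat \<Rightarrow> bool" where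
  "is_regular d \<longleftrightarrow> (\<forall>v\<in>V. card (neighbours v) = d)"

definition four_cycles :: "'a set set set" where
  "four_cycles = {C. C \<subseteq> E \<and> is_four_cycle C}"

lemma finite_neighbours: "finite (neighbours v)"
  by (rule finite_subset[OF _ finite_V]) (auto simp: neighbours_def edge_in_V)

lemma finite_four_cycles: "finite four_cycles"
  by (simp add: four_cycles_def finite_E)

lemma card_edges:
  assumes "is_regular d"
  shows "2 * card E = card V * d"
proof -
  have "card {e\<in>E. v \<in> e} = d" if "v \<in> V" for v
  proof -
    have "{e\<in>E. v \<in> e} \<subseteq> (\<lambda>u. {v, u}) ` neighbours v"
    proof
      fix e assume "e \<in> {e\<in>E. v \<in> e}"
      moreover from this obtain a b where "e = {a, b}" using edge_cases by blast
      ultimately show "e \<in> (\<lambda>u. {v, u}) ` neighbours v"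
        by (auto simp: neighbours_def insert_commute)
    qed
    then have "{e\<in>E. v \<in> e} = (\<lambda>u. {v, u}) ` neighbours v"
      by (auto simp: neighbours_def)
    moreover have "inj_on (\<lambda>u. {v, u}) (neighbours v)"
      by (auto simp: inj_on_def doubleton_eq_iff)
    ultimately show ?thesis using assms that by (simp add: card_image is_regular_def)
  qed
  then have "(\<Sum>v\<in>V. card {e\<in>E. v \<in> e}) = card V * d" by simp
  moreover have "card {v\<in>V. v \<in> e} = 2" if "e \<in> E" for e
  proof -
    obtain a b where "e = {a, b}" "a \<noteq> b" "a \<in> V" "b \<in> V" using edge_cases[OF \<open>e \<in> E\<close>] by blast
    then have "{v\<in>V. v \<in> e} = {a, b}" by auto
    with \<open>a \<noteq> b\<close> show ?thesis by simp
  qed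
  then have "(\<Sum>v\<in>V. card {e\<in>E. v \<in> e}) = 2 * card E"
    by (intro sum_multicount finite_V finite_E) blast
  ultimately show ?thesis by simp
qed

text \<open>Once \<open>u\<close> and \<open>v\<close> are told apart, the cycle determines
  \<open>w\<close> as the other neighbour of \<open>u\<close> on it and \<open>x\<close> as that of
  \<open>v\<close>, so no cycle is counted twice.\<close>

lemma card_four_cycles_through:
  assumes "triangle_free" "{u, v} \<in> E"
  shows "card {C\<in>four_cycles. {u, v} \<in> C} =
    card {(w, x) \<in> (neighbours u - {v}) \<times> (neighbours v - {u}). {w, x} \<in> E}"
proof -
  let ?P = "{(w, x) \<in> (neighbours u - {v}) \<times> (neighbours v - {u}). {w, x} \<in> E}"
  let ?f = "\<lambda>(w, x). {{u, v}, {u, w}, {v, x}, {w, x}}"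
  have dist: "distinct [u, v, w, x]" if "(w, x) \<in> ?P" for w x
  proof -
    have "{u, w} \<in> E" "{v, x} \<in> E" "{w, x} \<in> E" "w \<noteq> v" "x \<noteq> u"
      using that by (simp_all add: neighbours_def)
    then show ?thesis using edge_neq[OF assms(2)] edge_neq[of u w] edge_neq[of v x] edge_neq[of w x] by simp
  qed
  have "inj_on ?f ?P"
  proof (rule inj_onI)
    fix p p' assume P: "p \<in> ?P" "p' \<in> ?P" and f: "?f p = ?f p'"
    obtain w x w' x' where p: "p = (w, x)" "p' = (w', x')" by (metis surj_pair)
    have d: "distinct [u, v, w, x]" "distinct [u, v, w', x']" using P dist unfolding p by blast+
    have eq: "{{u, v}, {u, w}, {v, x}, {w, x}} = {{u, v}, {u, w'}, {v, x'}, {w', x'}}"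
      using f unfolding p by simp
    \<comment> \<open>By distinctness \<open>{u, w'}\<close> is the only edge of the second cycle
      that contains \<open>u\<close> but not \<open>v\<close>, and likewise \<open>{v, x'}\<close>
      with the roles of \<open>u\<close> and \<open>v\<close> exchanged.\<close>
    have "{u, w} \<in> {{u, v}, {u, w'}, {v, x'}, {w', x'}}" "{v, x} \<in> {{u, v}, {u, w'}, {v, x'}, {w', x'}}"
      unfolding eq[symmetric] by simp_all
    then show "p = p'" using d unfolding p by (simp add: doubleton_eq_iff) blast
  qed
  moreover have "?f ` ?P = {C\<in>four_cycles. {u, v} \<in> C}"
  proof (intro equalityI subsetI)
    fix C assume "C \<in> ?f ` ?P"
    then obtain w x where wx: "(w, x) \<in> ?P" "C = {{u, v}, {u, w}, {v, x}, {w, x}}"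
      by (elim imageE) (simp only: split_paired_all prod.case)
    have "is_four_cycle C" using dist[OF wx(1)] wx(2) unfolding is_four_cycle_def by blast
    then show "C \<in> {C\<in>four_cycles. {u, v} \<in> C}"
      using wx assms(2) by (simp add: four_cycles_def neighbours_def)
  next
    fix C assume "C \<in> {C\<in>four_cycles. {u, v} \<in> C}"
    then have C: "C \<subseteq> E" "is_four_cycle C" "{u, v} \<in> C" by (auto simp: four_cycles_def)
    obtain w x where wx: "distinct [u, v, w, x]" "C = {{u, v}, {u, w}, {v, x}, {w, x}}"
      using is_four_cycle_through[OF C(2,3)] .
    have ne: "w \<noteq> v" "x \<noteq> u" using wx(1) by auto
    show "C \<in> ?f ` ?P"
      by (rule image_eqI[of _ _ "(w, x)"]) (use C wx ne in \<open>simp_all add: neighbours_def\<close>)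
  qed
  ultimately show ?thesis using card_image[of ?f ?P] by simp
qed

lemma card_neighbours_product:
  assumes "is_regular d" "{u, v} \<in> E"
  shows "card ((neighbours u - {v}) \<times> (neighbours v - {u})) = (d - 1) ^ 2"
proof -
  have "v \<in> neighbours u" "u \<in> neighbours v"
    using assms(2) by (simp_all add: neighbours_def insert_commute)
  then have "card (neighbours u - {v}) = d - 1" "card (neighbours v - {u}) = d - 1"
    using assms(1) edge_in_V[OF assms(2)] by (simp_all add: card_Diff_singleton is_regular_def)
  then show ?thesis by (simp add: card_cartesian_product power2_eq_square)
qed

lemma card_four_cycles_through_le:
  assumes "is_regular d" "triangle_free" "e \<in> E"
  shows "card {C\<in>four_cycles. e \<in> C} \<le> (d - 1) ^ 2"
proof -
  obtain u v where e: "e = {u, v}" using edge_cases[OF assms(3)] by blast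
  have "finite ((neighbours u - {v}) \<times> (neighbours v - {u}))"
    by (simp add: finite_neighbours)
  from card_mono[OF this, of "{(w, x) \<in> (neighbours u - {v}) \<times> (neighbours v - {u}). {w, x} \<in> E}"]
  show ?thesis
    using card_four_cycles_through[OF assms(2), of u v] card_neighbours_product[OF assms(1), of u v]
      assms(3) unfolding e by (simp only:) blast
qed

lemma card_four_cycles_through_full:
  assumes "is_regular d" "full" "e \<in> E"
  shows "card {C\<in>four_cycles. e \<in> C} = (d - 1) ^ 2"
proof -
  obtain u v where e: "e = {u, v}" using edge_cases[OF assms(3)] by blast
  have "{(w, x) \<in> (neighbours u - {v}) \<times> (neighbours v - {u}). {w, x} \<in> E}
    = (neighbours u - {v}) \<times> (neighbours v - {u})"
    using assms(2)[unfolded full_def, rule_format, OF assms(3)[unfolded e]]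
    by (auto simp: neighbours_def)
  then show ?thesis
    using card_four_cycles_through[OF full_triangle_free, of u v] card_neighbours_product[of d u v] assms
    unfolding e by simp
qed

lemma sum_four_cycles_through: "(\<Sum>e\<in>E. card {C\<in>four_cycles. e \<in> C}) = 4 * card four_cycles"
proof (intro sum_multicount finite_E finite_four_cycles ballI)
  fix C assume "C \<in> four_cycles"
  then have "{e\<in>E. e \<in> C} = C" "card C = 4"
    by (auto simp: four_cycles_def card_four_cycle)
  then show "card {e\<in>E. e \<in> C} = 4" by simp
qed

lemma card_four_cycles_full:
  assumes "is_regular d" "full"
  shows "4 * card four_cycles = card E * (d - 1) ^ 2"
  unfolding sum_four_cycles_through[symmetric]
  by (simp add: card_four_cycles_through_full[OF assms])

text \<open>A walk w - u - v - x that does not close up is a missing pair for the edge uv, so the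
  bound is strict at this edge; summing over all edges keeps the strictness.\<close>

lemma card_four_cycles_not_full:
  assumes "is_regular d" "triangle_free" "\<not> full"
  shows "4 * card four_cycles < card E * (d - 1) ^ 2"
proof -
  obtain u v w x where *: "{u, v} \<in> E" "{u, w} \<in> E" "{v, x} \<in> E" "{w, x} \<notin> E"
    using assms(3) unfolding full_def by blast
  \<comment> \<open>Walks that turn back close up by themselves: for \<open>w = v\<close> the pair
    wx is the edge vx, for \<open>x = u\<close> it is the edge uw.\<close>
  have "w \<noteq> v" "x \<noteq> u" using * by (auto simp: insert_commute)
  with * have "(w, x) \<in> (neighbours u - {v}) \<times> (neighbours v - {u})"
    by (simp add: neighbours_def)
  with * have "{(w, x) \<in> (neighbours u - {v}) \<times> (neighbours v - {u}). {w, x} \<in> E}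
      \<subset> (neighbours u - {v}) \<times> (neighbours v - {u})" by blast
  from psubset_card_mono[OF _ this] have "card {C\<in>four_cycles. {u, v} \<in> C} < (d - 1) ^ 2"
    unfolding card_four_cycles_through[OF assms(2) *(1)] card_neighbours_product[OF assms(1) *(1)]
    by (simp add: finite_neighbours)
  with * have "(\<Sum>e\<in>E. card {C\<in>four_cycles. e \<in> C}) < (\<Sum>e\<in>E. (d - 1) ^ 2)"
    using card_four_cycles_through_le[OF assms(1,2)] by (intro sum_strict_mono_ex1 finite_E) auto
  then show ?thesis unfolding sum_four_cycles_through by simp
qed

text \<open>Such a set is a 4-cycle plus one of the \<open>card E - 4\<close> remaining edges;
  counting a set more than once does no harm to an upper bound.\<close>

lemma card_5_sets_with_four_cycle:
  "card {F\<in>subsets_of_size 5 E. \<exists>C\<subseteq>F. is_four_cycle C} \<le> card four_cycles * (card E - 4)"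
proof -
  have "{F\<in>subsets_of_size 5 E. \<exists>C\<subseteq>F. is_four_cycle C}
    \<subseteq> (\<lambda>(C, e). insert e C) ` Sigma four_cycles (\<lambda>C. E - C)"
  proof
    fix F assume "F \<in> {F\<in>subsets_of_size 5 E. \<exists>C\<subseteq>F. is_four_cycle C}"
    then obtain C where F: "F \<subseteq> E" "card F = 5" and C: "C \<subseteq> F" "is_four_cycle C"
      by (auto simp: subsets_of_size_def)
    then have "card (F - C) = 1"
      using card_four_cycle[of C] finite_subset_E[of C] by (subst card_Diff_subset) auto
    then obtain e where "F - C = {e}" by (auto simp: card_1_singleton_iff)
    then have "F = insert e C" "e \<in> E - C" using C(1) F(1) by blast+
    with C F show "F \<in> (\<lambda>(C, e). insert e C) ` Sigma four_cycles (\<lambda>C. E - C)"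
      by (intro image_eqI[of _ _ "(C, e)"]) (auto simp: four_cycles_def)
  qed
  then have "card {F\<in>subsets_of_size 5 E. \<exists>C\<subseteq>F. is_four_cycle C}
    \<le> card (Sigma four_cycles (\<lambda>C. E - C))"
    by (rule surj_card_le[rotated]) (simp add: finite_four_cycles finite_E)
  also have "\<dots> = (\<Sum>C\<in>four_cycles. card (E - C))"
    by (simp add: finite_four_cycles finite_E)
  also have "\<dots> = (\<Sum>C\<in>four_cycles. card E - 4)"
  proof (rule sum.cong)
    fix C assume "C \<in> four_cycles"
    then have "C \<subseteq> E" "card C = 4" by (auto simp: four_cycles_def card_four_cycle)
    then show "card (E - C) = card E - 4"
      by (simp add: card_Diff_subset finite_subset_E)
  qed simp
  finally show ?thesis by simp
qed

end

section \<open>The terms of the Bonferroni sums\<close>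

context coloured_graph
begin

lemma bonferroni_le_4: "proper_prob \<le> prob_sum 0 - prob_sum 1 + prob_sum 2 - prob_sum 3 + prob_sum 4"
proof -
  have "even (4 :: nat)" by simp
  from bonferroni(1)[OF this] show ?thesis by (simp add: eval_nat_numeral)
qed

lemma bonferroni_ge_3: "prob_sum 0 - prob_sum 1 + prob_sum 2 - prob_sum 3 \<le> proper_prob"
proof -
  have "odd (3 :: nat)" by simp
  from bonferroni(2)[OF this] show ?thesis by (simp add: eval_nat_numeral)
qed

lemma bonferroni_ge_5: "prob_sum 0 - prob_sum 1 + prob_sum 2 - prob_sum 3 + prob_sum 4 - prob_sum 5 \<le> proper_prob"
proof -
  have "odd (5 :: nat)" by simp
  from bonferroni(2)[OF this] show ?thesis by (simp add: eval_nat_numeral)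
qed

lemma prob_sum_const:
  fixes a :: real
  assumes "\<And>F. F \<in> subsets_of_size j E \<Longrightarrow> prob F = a"
  shows "prob_sum j = (card E choose j) * a"
  unfolding prob_sum_def using assms by (simp add: card_subsets_of_size finite_E)

lemma prob_sum_0: "prob_sum 0 = 1"
  using prob_sum_const[OF prob_0] by simp

lemma prob_sum_1: "prob_sum 1 = card E / q"
  using prob_sum_const[OF prob_1] by simp

lemma prob_sum_2: "prob_sum 2 = (card E choose 2) / q ^ 2"
  using prob_sum_const[OF prob_2] by simp

lemma prob_sum_3: "triangle_free \<Longrightarrow> prob_sum 3 = (card E choose 3) / q ^ 3"
  using prob_sum_const[of 3, OF prob_3] by (simp add: triangle_free_def subsets_of_size_def)

text \<open>One triangle is singled out with its larger probability; all other triples, triangles or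
  not, have probability at least \<open>1 / q ^ 3\<close>.\<close>

lemma prob_sum_3_triangle:
  assumes "\<not> triangle_free"
  shows "prob_sum 3 \<ge> (real (card E choose 3) - 1) / q ^ 3 + 1 / q ^ 2"
proof -
  obtain T where T: "T \<subseteq> E" "is_triangle T" using assms by (auto simp: triangle_free_def)
  then have T3: "T \<in> subsets_of_size 3 E" by (simp add: subsets_of_size_def card_triangle)
  have fin: "finite (subsets_of_size 3 E)" by (simp add: finite_subsets_of_size finite_E)
  have "prob F \<ge> 1 / q ^ 3" if "F \<in> subsets_of_size 3 E" for F
  proof (cases "is_triangle F")
    case True
    then have "prob F = 1 / q ^ 2" using that by (intro prob_triangle) (auto simp: subsets_of_size_def)
    then show ?thesis using q_pos by (simp add: field_simps eval_nat_numeral)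
  qed (use prob_3 that in simp)
  then have "(\<Sum>F\<in>subsets_of_size 3 E - {T}. prob F) \<ge> (\<Sum>F\<in>subsets_of_size 3 E - {T}. 1 / q ^ 3)"
    by (intro sum_mono) auto
  moreover have "card (subsets_of_size 3 E) \<ge> 1"
    using T3 fin by (metis One_nat_def Suc_leI card_gt_0_iff empty_iff)
  then have "(\<Sum>F\<in>subsets_of_size 3 E - {T}. 1 / q ^ 3) = (real (card E choose 3) - 1) / q ^ 3"
    using T3 fin by (simp add: card_Diff_singleton card_subsets_of_size finite_E of_nat_diff)
  moreover have "prob_sum 3 = prob T + (\<Sum>F\<in>subsets_of_size 3 E - {T}. prob F)"
    unfolding prob_sum_def by (rule sum.remove[OF fin T3])
  moreover have "prob T = 1 / q ^ 2" using prob_triangle T by auto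
  ultimately show ?thesis by linarith
qed

lemma prob_sum_4_le: "prob_sum 4 \<le> (card E choose 4) / q ^ 3"
proof -
  have "prob_sum 4 \<le> (\<Sum>F\<in>subsets_of_size 4 E. 1 / q ^ 3)"
    unfolding prob_sum_def by (intro sum_mono prob_4_le)
  then show ?thesis by (simp add: card_subsets_of_size finite_E)
qed

lemma prob_sum_4:
  assumes "triangle_free"
  shows "prob_sum 4 = card four_cycles / q ^ 3 + (real (card E choose 4) - card four_cycles) / q ^ 4"
proof -
  have fin: "finite (subsets_of_size 4 E)" by (simp add: finite_subsets_of_size finite_E)
  have sub: "four_cycles \<subseteq> subsets_of_size 4 E"
    by (auto simp: four_cycles_def subsets_of_size_def card_four_cycle)
  have "(\<Sum>F\<in>four_cycles. prob F) = (\<Sum>F\<in>four_cycles. 1 / q ^ 3)"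
    using assms by (intro sum.cong prob_four_cycle) (auto simp: four_cycles_def)
  moreover have "(\<Sum>F\<in>subsets_of_size 4 E - four_cycles. prob F)
      = (\<Sum>F\<in>subsets_of_size 4 E - four_cycles. 1 / q ^ 4)"
    using assms by (intro sum.cong prob_4) (auto simp: four_cycles_def subsets_of_size_def)
  moreover have "card (subsets_of_size 4 E - four_cycles) = (card E choose 4) - card four_cycles"
    using sub by (simp add: card_Diff_subset finite_four_cycles card_subsets_of_size finite_E)
  moreover have "card four_cycles \<le> (card E choose 4)"
    using card_mono[OF fin sub] by (simp add: card_subsets_of_size finite_E)
  moreover have "prob_sum 4 = (\<Sum>F\<in>subsets_of_size 4 E - four_cycles. prob F) + (\<Sum>F\<in>four_cycles. prob F)"
    unfolding prob_sum_def by (rule sum.subset_diff[OF sub fin])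
  ultimately show ?thesis by (simp add: of_nat_diff)
qed

text \<open>Sets that contain a 4-cycle are few but may be as likely as \<open>1 / q ^ 4\<close>;
  the others have probability exactly \<open>1 / q ^ 5\<close> and are bounded by the number of all
  5-sets.\<close>

lemma prob_sum_5_le:
  assumes "full"
  shows "prob_sum 5 \<le> card four_cycles * (card E - 4) / q ^ 4 + (card E choose 5) / q ^ 5"
proof -
  let ?A = "{F\<in>subsets_of_size 5 E. \<exists>C\<subseteq>F. is_four_cycle C}"
  have fin: "finite (subsets_of_size 5 E)" by (simp add: finite_subsets_of_size finite_E)
  have "(\<Sum>F\<in>?A. prob F) \<le> (\<Sum>F\<in>?A. 1 / q ^ 4)"
    using prob_5_le(1)[OF _ assms] by (intro sum_mono) auto
  also have "\<dots> = card ?A / q ^ 4" by simp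
  also have "\<dots> \<le> (card four_cycles * (card E - 4)) / q ^ 4"
    using card_5_sets_with_four_cycle by (intro divide_right_mono of_nat_mono) auto
  finally have A: "(\<Sum>F\<in>?A. prob F) \<le> (card four_cycles * (card E - 4)) / q ^ 4" .
  have "(\<Sum>F\<in>subsets_of_size 5 E - ?A. prob F) = (\<Sum>F\<in>subsets_of_size 5 E - ?A. 1 / q ^ 5)"
    using prob_5_le(2)[OF _ assms] by (intro sum.cong) auto
  also have "\<dots> \<le> (\<Sum>F\<in>subsets_of_size 5 E. 1 / q ^ 5)"
    by (intro sum_mono2 fin) auto
  also have "\<dots> = (card E choose 5) / q ^ 5" by (simp add: card_subsets_of_size finite_E)
  finally have B: "(\<Sum>F\<in>subsets_of_size 5 E - ?A. prob F) \<le> (card E choose 5) / q ^ 5" .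
  have "prob_sum 5 = (\<Sum>F\<in>subsets_of_size 5 E - ?A. prob F) + (\<Sum>F\<in>?A. prob F)"
    unfolding prob_sum_def by (rule sum.subset_diff[OF _ fin]) auto
  with A B show ?thesis by linarith
qed

end

section \<open>Comparing a full graph with another one\<close>

text \<open>Stated with \<open>k + 4\<close> so that the falling factorial is free of truncated
  subtraction.\<close>

lemma binomial_4: "24 * real ((k + 4) choose 4) = (k + 4) * (k + 3) * (k + 2) * (k + 1)"
proof -
  have 2: "2 * ((k + 2) choose 2) = (k + 2) * (k + 1)"
    using Suc_times_binomial_eq[of "k + 1" 1] by (simp add: eval_nat_numeral)
  have 3: "3 * ((k + 3) choose 3) = (k + 3) * ((k + 2) choose 2)"
    using Suc_times_binomial_eq[of "k + 2" 2] by (simp add: eval_nat_numeral)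
  have 4: "4 * ((k + 4) choose 4) = (k + 4) * ((k + 3) choose 3)"
    using Suc_times_binomial_eq[of "k + 3" 3] by (simp add: eval_nat_numeral)
  have "24 * ((k + 4) choose 4) = 6 * (4 * ((k + 4) choose 4))" by simp
  also have "\<dots> = 2 * (k + 4) * (3 * ((k + 3) choose 3))" unfolding 4 by simp
  also have "\<dots> = (k + 4) * (k + 3) * (2 * ((k + 2) choose 2))" unfolding 3 by simp
  also have "\<dots> = (k + 4) * (k + 3) * (k + 2) * (k + 1)" unfolding 2 by (simp only: mult.assoc)
  finally have "24 * ((k + 4) choose 4) = \<dots>" .
  then show ?thesis by (metis of_nat_mult of_nat_numeral)
qed

lemma binomial_5: "5 * real ((k + 4) choose 5) = k * real ((k + 4) choose 4)"
proof -
  have "5 * ((k + 4) choose 5) = k * ((k + 4) choose 4)"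
    using binomial_absorb_comp[of "k + 4" 4] binomial_absorption[of 4 "k + 4"] by simp
  then show ?thesis by (metis of_nat_mult of_nat_numeral)
qed

text \<open>Multiplied by \<open>q ^ 5\<close>, the gain is at least \<open>Q * (Q - 1)\<close>,
  hence at least \<open>Q * (2 * A)\<close>. The loss is \<open>c' * k * Q + B\<close>, where
  \<open>B = A * k / 5\<close> is at most \<open>Q * (k / 10)\<close>. So everything reduces to
  \<open>key\<close>, an inequality in which a cubic bound on \<open>c' * k\<close> meets the
  quartic \<open>A\<close>.\<close>

lemma four_cycle_estimate:
  fixes c c' m d q :: nat
  assumes "d \<ge> 2" "m \<ge> d\<^sup>2" "4 * c < m * (d - 1)\<^sup>2" "4 * c' = m * (d - 1)\<^sup>2"
    and q: "q > 2 * (m choose 4)"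
  shows "c / q ^ 3 + (real (m choose 4) - c) / q ^ 4
    < c' / q ^ 3 + (real (m choose 4) - c') / q ^ 4
      - ((c' * (m - 4)) / q ^ 4 + (m choose 5) / q ^ 5)"
proof -
  have "m \<ge> 4" using power_mono[of 2 d 2] assms(1,2) by simp
  define k where "k = m - 4"
  have m: "m = k + 4" using \<open>m \<ge> 4\<close> by (simp add: k_def)
  define Q where "Q = real q"
  define A where "A = real (m choose 4)"
  have A: "24 * A = (real k + 4) * (real k + 3) * (real k + 2) * (real k + 1)"
    unfolding A_def m binomial_4 by (simp add: algebra_simps)
  define B where "B = real (m choose 5)"
  have B: "5 * B = A * k" unfolding A_def B_def m binomial_5 by (rule mult.commute)
  have Q: "Q \<ge> 2 * A + 1" using q unfolding Q_def A_def by linarith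
  \<comment> \<open>The squares of \<open>d\<close> and \<open>d - 1\<close> differ by
    \<open>2 * d - 1\<close>, which is at least 3. The 3 turns into the bound \<open>k + 1\<close>
    because \<open>m = k + 4\<close>.\<close>
  have "(d - 1)\<^sup>2 + 3 \<le> m"
  proof -
    obtain e where e: "d = e + 2" using assms(1) by (metis add.commute le_Suc_ex)
    have "(d - 1)\<^sup>2 + 3 \<le> d\<^sup>2" unfolding e by (simp add: power2_eq_square algebra_simps)
    then show ?thesis using assms(2) by simp
  qed
  then have d: "(d - 1)\<^sup>2 \<le> k + 1" using m by simp
  have "4 * c' \<le> (k + 4) * (k + 1)" unfolding assms(4) m using d by (intro mult_le_mono) auto
  then have c': "4 * real c' \<le> (real k + 4) * (real k + 1)"
    by (metis (mono_tags) of_nat_1 of_nat_add of_nat_le_iff of_nat_mult of_nat_numeral)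
  have "c < c'" using assms(3) unfolding assms(4)[symmetric] by simp
  then have cc: "real c + 1 \<le> real c'" by simp
  have k0: "real k \<ge> 0" by simp
  have A0: "A \<ge> 1"
  proof -
    have "(real k + 4) * (real k + 3) * (real k + 2) * (real k + 1) \<ge> 4 * 3 * 2 * 1"
      by (intro mult_mono) auto
    with A show ?thesis by simp
  qed
  then have Q0: "Q > 0" using Q by simp
  have key: "real c' * k + k / 10 < 2 * A"
  proof -
    have "4 * (real c' * k) \<le> (real k + 4) * (real k + 1) * k"
      using mult_right_mono[OF c' k0] by simp
    \<comment> \<open>This is \<open>key\<close> multiplied by 12, with the cubic bound in place of
      \<open>c' * k\<close>; all coefficients of the difference are positive.\<close>
    moreover have "24 * A - 3 * ((real k + 4) * (real k + 1) * k) - 12 * (k / 10)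
        = real k ^ 4 + 7 * real k ^ 3 + 20 * real k ^ 2 + 184 / 5 * k + 24"
      unfolding A by (simp add: algebra_simps power2_eq_square power3_eq_cube power4_eq_xxxx)
    moreover have "\<dots> > 0" by (intro add_nonneg_pos add_nonneg_nonneg) auto
    ultimately show ?thesis by linarith
  qed
  have "(c' * k) * Q + B < Q * Q - Q"
  proof -
    have "B \<le> Q * (k / 10)"
      using mult_right_mono[of "2 * A" Q "k / 10"] Q k0 B by simp
    moreover have "Q * (c' * k + k / 10) < Q * (2 * A)" using key Q0 by (intro mult_strict_left_mono) auto
    moreover have "Q * (2 * A) \<le> Q * (Q - 1)" using Q Q0 by (intro mult_left_mono) auto
    ultimately show ?thesis by (simp add: algebra_simps)
  qed
  moreover have "Q * Q - Q \<ge> 0" using mult_right_mono[of 1 Q Q] Q A0 by simp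
  then have "(Q * Q - Q) * 1 \<le> (Q * Q - Q) * (real c' - c)"
    using cc by (intro mult_left_mono) auto
  ultimately have "0 < ((Q * Q - Q) * (real c' - c) - (c' * k) * Q - B) / Q ^ 5"
    using Q0 by (intro divide_pos_pos) auto
  also have "\<dots> = (c' / Q ^ 3 + (A - c') / Q ^ 4 - ((c' * k) / Q ^ 4 + B / Q ^ 5))
    - (c / Q ^ 3 + (A - c) / Q ^ 4)"
    using Q0 by (simp add: field_simps eval_nat_numeral)
  finally show ?thesis unfolding A_def B_def Q_def k_def by simp
qed

text \<open>Equal order and degree give equal numbers of edges, so orders 0 to 2 cancel. Without
  triangles order 3 cancels as well and the 4-cycles decide; with a triangle, order 3 already
  decides.\<close>

lemma proper_prob_less_full:
  assumes "coloured_graph V E q" "coloured_graph V' E' q"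
    and "card V = card V'" "simple_graph.is_regular V E d" "simple_graph.is_regular V' E' d"
    and "\<not> simple_graph.full E" "simple_graph.full E'"
    and "d \<ge> 2" "card E \<ge> d\<^sup>2" and q: "q > 2 * (card E choose 4)"
  shows "coloured_graph.proper_prob V E q < coloured_graph.proper_prob V' E' q"
proof -
  interpret G: coloured_graph V E q by fact
  interpret H: coloured_graph V' E' q by fact
  define m where "m = card E"
  have m: "card E = m" "card E' = m"
    using G.card_edges[OF assms(4)] H.card_edges[OF assms(5)] assms(3) by (simp_all add: m_def)
  note tf' = H.full_triangle_free[OF assms(7)]
  have Q: "real q > 0" using G.q_pos by simp
  show ?thesis
  proof (cases "G.triangle_free")
    case True
    have "G.proper_prob \<le> 1 - m / q + (m choose 2) / q ^ 2 - (m choose 3) / q ^ 3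
      + (G.prob_sum 4)"
      using G.bonferroni_le_4 G.prob_sum_0 G.prob_sum_1 G.prob_sum_2 m by (simp add: G.prob_sum_3[OF True])
    moreover have "H.proper_prob \<ge> 1 - m / q + (m choose 2) / q ^ 2 - (m choose 3) / q ^ 3
      + H.prob_sum 4 - H.prob_sum 5"
      using H.bonferroni_ge_5 H.prob_sum_0 H.prob_sum_1 H.prob_sum_2 H.prob_sum_3[OF tf'] m by simp
    moreover have "G.prob_sum 4 < H.prob_sum 4 - H.prob_sum 5"
      using four_cycle_estimate[of d m "card G.four_cycles" "card H.four_cycles" q]
        G.card_four_cycles_not_full[OF assms(4) True assms(6)] H.card_four_cycles_full[OF assms(5,7)]
        H.prob_sum_5_le[OF assms(7)] assms(8,9) q
      unfolding G.prob_sum_4[OF True] H.prob_sum_4[OF tf'] m by linarith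
    ultimately show ?thesis by linarith
  next
    case False
    have "G.proper_prob \<le> 1 - m / q + (m choose 2) / q ^ 2 - G.prob_sum 3 + G.prob_sum 4"
      using G.bonferroni_le_4 G.prob_sum_0 G.prob_sum_1 G.prob_sum_2 m by simp
    moreover have "H.proper_prob \<ge> 1 - m / q + (m choose 2) / q ^ 2 - (m choose 3) / q ^ 3"
      using H.bonferroni_ge_3 H.prob_sum_0 H.prob_sum_1 H.prob_sum_2 H.prob_sum_3[OF tf'] m by simp
    moreover have "G.prob_sum 3 \<ge> (real (m choose 3) - 1) / q ^ 3 + 1 / q ^ 2"
      using G.prob_sum_3_triangle[OF False] m by simp
    moreover have "G.prob_sum 4 \<le> (m choose 4) / q ^ 3" using G.prob_sum_4_le m by simp
    moreover have "(m choose 4) / q ^ 3 < 1 / real q ^ 2 - 1 / q ^ 3"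
    proof -
      have "m \<ge> 4" using power_mono[of 2 d 2] assms(8,9) m by simp
      then have "(m choose 4) \<ge> 1" by (simp add: Suc_leI)
      \<comment> \<open>The bound on \<open>q\<close> gives \<open>q - 1\<close> at least
        \<open>2 * (m choose 4)\<close>, and the binomial is positive.\<close>
      then have "real (m choose 4) < real q - 1" using q m by simp
      then have "(m choose 4) / real q ^ 3 < (real q - 1) / real q ^ 3"
        using Q by (intro divide_strict_right_mono) auto
      also have "\<dots> = 1 / real q ^ 2 - 1 / q ^ 3" using Q by (simp add: field_simps eval_nat_numeral)
      finally show ?thesis by simp
    qed
    moreover have "(real (m choose 3) - 1) / q ^ 3 = (m choose 3) / q ^ 3 - 1 / q ^ 3"
      by (simp add: diff_divide_distrib)
    ultimately show ?thesis unfolding of_nat_power by linarith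
  qed
qed

section \<open>Disjoint copies of complete bipartite graphs\<close>

text \<open>Generalised to neighbour-closed sets \<open>W\<close> so that one copy can be removed at
  a time. For an edge uw, \<open>full\<close> joins the neighbourhoods \<open>A\<close> of
  \<open>u\<close> and \<open>B\<close> of \<open>w\<close> completely, and since all degrees are
  \<open>d\<close> there is no room for further neighbours: \<open>A\<close> and \<open>B\<close>
  span a component. The value of \<open>\<phi>\<close> is the number of the copy together with a
  vertex tagged by its side.\<close>

lemma (in simple_graph) full_closed_decomposition:
  assumes "full" "is_regular d" "d \<ge> 1"
  shows "W \<subseteq> V \<Longrightarrow> (\<forall>u\<in>W. neighbours u \<subseteq> W) \<Longrightarrow> card W = 2 * d * k \<Longrightarrow>
    \<exists>\<phi>. bij_betw \<phi> W ({..<k} \<times> ({..<d} <+> {..<d})) \<and>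
      (\<forall>u\<in>W. \<forall>v\<in>W. {u, v} \<in> E \<longleftrightarrow>
        fst (\<phi> u) = fst (\<phi> v) \<and> isl (snd (\<phi> u)) \<noteq> isl (snd (\<phi> v)))"
proof (induction k arbitrary: W)
  case 0
  then have "W = {}" using finite_V finite_subset by fastforce
  then show ?case by (auto simp: bij_betw_def)
next
  case (Suc k)
  have finW: "finite W" using Suc.prems(1) finite_V finite_subset by blast
  have "W \<noteq> {}" using Suc.prems(3) assms(3) by auto
  then obtain w where w: "w \<in> W" by auto
  have card_nb: "card (neighbours v) = d" if "v \<in> W" for v
    using that Suc.prems(1) assms(2) by (auto simp: is_regular_def)
  have "neighbours w \<noteq> {}" using card_nb[OF w] assms(3) by auto
  then obtain u where uw: "{u, w} \<in> E" by (auto simp: neighbours_def insert_commute)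
  define A where "A = neighbours u"
  define B where "B = neighbours w"
  have "u \<in> neighbours w" using uw by (simp add: neighbours_def insert_commute)
  then have u: "u \<in> W" using w Suc.prems(2) by blast
  have AW: "A \<subseteq> W" and BW: "B \<subseteq> W" using u w Suc.prems(2) by (auto simp: A_def B_def)
  have cA: "card A = d" and cB: "card B = d" using card_nb u w by (auto simp: A_def B_def)
  have finA: "finite A" and finB: "finite B" by (simp_all add: A_def B_def finite_neighbours)
  have AB: "{a, b} \<in> E" if "a \<in> A" "b \<in> B" for a b
    using assms(1)[unfolded full_def, rule_format, OF uw, of a b] that
    by (simp add: A_def B_def neighbours_def)
  have disj: "A \<inter> B = {}" using AB edge_neq by blast
  have nA: "neighbours a = B" if "a \<in> A" for a
  proof (rule card_subset_eq[symmetric])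
    show "B \<subseteq> neighbours a" using AB that by (auto simp: neighbours_def)
    show "card B = card (neighbours a)" using cB card_nb that AW by auto
  qed (rule finite_neighbours)
  have nB: "neighbours b = A" if "b \<in> B" for b
  proof (rule card_subset_eq[symmetric])
    show "A \<subseteq> neighbours b" using AB that by (auto simp: neighbours_def insert_commute)
    show "card A = card (neighbours b)" using cA card_nb that BW by auto
  qed (rule finite_neighbours)
  define W' where "W' = W - (A \<union> B)"
  have W: "W = W' \<union> (A \<union> B)" using AW BW by (auto simp: W'_def)
  have "card (A \<union> B) = 2 * d" using disj cA cB finA finB by (simp add: card_Un_disjoint)
  then have "card W' = 2 * d * k"
    using AW BW finA finB Suc.prems(3) by (simp add: W'_def card_Diff_subset)
  moreover have "\<forall>v\<in>W'. neighbours v \<subseteq> W'"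
  proof (intro ballI subsetI)
    fix v x assume v: "v \<in> W'" and x: "x \<in> neighbours v"
    then have "v \<in> neighbours x" by (simp add: neighbours_def insert_commute)
    \<comment> \<open>If \<open>x\<close> were in \<open>A\<close> or \<open>B\<close>, its
      neighbour \<open>v\<close> would lie in the other one.\<close>
    then have "x \<notin> A" "x \<notin> B" using nA nB v by (auto simp: W'_def)
    then show "x \<in> W'" using Suc.prems(2) v x by (auto simp: W'_def)
  qed
  moreover have "W' \<subseteq> V" using Suc.prems(1) by (auto simp: W'_def)
  ultimately obtain \<phi> where \<phi>: "bij_betw \<phi> W' ({..<k} \<times> ({..<d} <+> {..<d}))"
    and \<phi>E: "\<And>u v. u \<in> W' \<Longrightarrow> v \<in> W' \<Longrightarrow> {u, v} \<in> E \<longleftrightarrow>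
        fst (\<phi> u) = fst (\<phi> v) \<and> isl (snd (\<phi> u)) \<noteq> isl (snd (\<phi> v))"
    using Suc.IH[of W'] by blast
  obtain g where g: "bij_betw g A {..<d}"
    using finA cA by (metis ex_bij_betw_finite_nat atLeast0LessThan)
  obtain h where h: "bij_betw h B {..<d}"
    using finB cB by (metis ex_bij_betw_finite_nat atLeast0LessThan)
  define \<psi> where "\<psi> v = (if v \<in> A then (k, Inl (g v)) else if v \<in> B then (k, Inr (h v)) else \<phi> v)" for v
  have \<psi>A: "\<psi> a = (k, Inl (g a))" if "a \<in> A" for a using that by (simp add: \<psi>_def)
  have \<psi>B: "\<psi> b = (k, Inr (h b))" if "b \<in> B" for b using that disj by (auto simp: \<psi>_def)
  have \<psi>W: "\<psi> v = \<phi> v" if "v \<in> W'" for v using that by (auto simp: \<psi>_def W'_def)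
  have bA: "bij_betw \<psi> A ({k} \<times> Inl ` {..<d})"
    using g \<psi>A by (auto simp: bij_betw_def inj_on_def image_iff)
  have bB: "bij_betw \<psi> B ({k} \<times> Inr ` {..<d})"
    using h \<psi>B by (auto simp: bij_betw_def inj_on_def image_iff)
  have bW: "bij_betw \<psi> W' ({..<k} \<times> ({..<d} <+> {..<d}))"
    using \<phi> \<psi>W by (simp cong: bij_betw_cong)
  have "bij_betw \<psi> (A \<union> B) ({k} \<times> Inl ` {..<d} \<union> {k} \<times> Inr ` {..<d})"
    by (rule bij_betw_combine[OF bA bB]) auto
  then have "bij_betw \<psi> (W' \<union> (A \<union> B)) ({..<k} \<times> ({..<d} <+> {..<d}) \<union>
      ({k} \<times> Inl ` {..<d} \<union> {k} \<times> Inr ` {..<d}))"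
    by (rule bij_betw_combine[OF bW]) auto
  moreover have "{..<k} \<times> ({..<d} <+> {..<d}) \<union> ({k} \<times> Inl ` {..<d} \<union> {k} \<times> Inr ` {..<d})
      = {..<Suc k} \<times> ({..<d} <+> {..<d})"
    by (auto simp: less_Suc_eq Plus_def)
  ultimately have bij: "bij_betw \<psi> W ({..<Suc k} \<times> ({..<d} <+> {..<d}))" by (simp add: W)
  have k: "fst (\<psi> v) < k" if "v \<in> W'" for v
    using bij_betw_apply[OF bW that] by auto
  have sA: "fst (\<psi> v) = k \<and> isl (snd (\<psi> v))" if "v \<in> A" for v using \<psi>A that by simp
  have sB: "fst (\<psi> v) = k \<and> \<not> isl (snd (\<psi> v))" if "v \<in> B" for v using \<psi>B that by simp
  have W_cases: "v \<in> A \<or> v \<in> B \<or> v \<in> W'" if "v \<in> W" for v using that unfolding W by blast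
  have AB_notin: "v \<notin> B" if "v \<in> A" for v using that disj by blast
  have W'_notin: "v \<notin> A \<and> v \<notin> B" if "v \<in> W'" for v using that by (simp add: W'_def)
  have adj: "{u, v} \<in> E \<longleftrightarrow> fst (\<psi> u) = fst (\<psi> v) \<and> isl (snd (\<psi> u)) \<noteq> isl (snd (\<psi> v))"
    if uv: "u \<in> W" "v \<in> W" for u v
  proof -
    have nb: "{u, v} \<in> E \<longleftrightarrow> v \<in> neighbours u" "{u, v} \<in> E \<longleftrightarrow> u \<in> neighbours v"
      by (simp_all add: neighbours_def insert_commute)
    consider "u \<in> A" | "u \<in> B" | "u \<in> W'" "v \<in> A" | "u \<in> W'" "v \<in> B" | "u \<in> W'" "v \<in> W'"
      using uv[THEN W_cases] by blast
    then show ?thesis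
    proof cases
      case 1
      from nb(1) nA[OF 1] have iff: "{u, v} \<in> E \<longleftrightarrow> v \<in> B" by simp
      have "?thesis" if "v \<in> A" using that iff AB_notin[OF that] sA[OF 1] sA[OF that] by simp
      moreover have "?thesis" if "v \<in> B" using that iff sA[OF 1] sB[OF that] by simp
      moreover have "?thesis" if "v \<in> W'" using that iff W'_notin[OF that] sA[OF 1] k[OF that] by simp
      ultimately show ?thesis using W_cases[OF uv(2)] by blast
    next
      case 2
      from nb(1) nB[OF 2] have iff: "{u, v} \<in> E \<longleftrightarrow> v \<in> A" by simp
      have "?thesis" if "v \<in> A" using that iff AB_notin[OF that] sB[OF 2] sA[OF that] by simp
      moreover have "?thesis" if "v \<in> B" using iff AB_notin[of v] that sB[OF 2] sB[OF that] by blast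
      moreover have "?thesis" if "v \<in> W'" using that iff W'_notin[OF that] sB[OF 2] k[OF that] by simp
      ultimately show ?thesis using W_cases[OF uv(2)] by blast
    next
      case 3
      then have "u \<notin> B" by (simp add: W'_def)
      with nb(2) nA[OF 3(2)] have "{u, v} \<notin> E" by simp
      then show ?thesis using sA[OF 3(2)] k[OF 3(1)] by simp
    next
      case 4
      then have "u \<notin> A" by (simp add: W'_def)
      with nb(2) nB[OF 4(2)] have "{u, v} \<notin> E" by simp
      then show ?thesis using sB[OF 4(2)] k[OF 4(1)] by simp
    next
      case 5
      then show ?thesis using \<phi>E \<psi>W by simp
    qed
  qed
  show ?case using bij adj by blast
qed

text \<open>In a perfect matching a walk of length three can only go back and forth on one edge.
  This settles \<open>d = 1\<close>, where there are no 4-cycles to compare.\<close>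

lemma (in simple_graph) regular_1_full: "is_regular 1 \<Longrightarrow> full"
  unfolding full_def
proof (intro allI impI)
  fix u v w x assume reg: "is_regular 1" and E: "{u, v} \<in> E" "{u, w} \<in> E" "{v, x} \<in> E"
  have "card (neighbours u) = 1" "card (neighbours v) = 1"
    using reg edge_in_V[OF E(1)] by (simp_all add: is_regular_def)
  moreover have "v \<in> neighbours u" "w \<in> neighbours u" "u \<in> neighbours v" "x \<in> neighbours v"
    using E by (simp_all add: neighbours_def insert_commute)
  ultimately have "w = v" "x = u" by (auto simp: card_1_singleton_iff)
  with E show "{w, x} \<in> E" by (simp add: insert_commute)
qed

section \<open>From symmetric arc relations to doubleton edges, and isomorphism\<close>

definition edges :: "'a pair_pre_digraph \<Rightarrow> 'a set set" where
  "edges G = (\<lambda>(u, v). {u, v}) ` parcs G"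

lemma (in pair_graph) arc_commute: "(u, v) \<in> parcs G \<longleftrightarrow> (v, u) \<in> parcs G"
  using arcs_symmetric by blast

lemma (in pair_graph) doubleton_in_edges: "{u, v} \<in> edges G \<longleftrightarrow> (u, v) \<in> parcs G"
  using arc_commute by (auto simp: edges_def doubleton_eq_iff)

lemma (in pair_graph) simple_graph_edges: "simple_graph (pverts G) (edges G)"
proof
  show "\<exists>u v. e = {u, v} \<and> u \<noteq> v \<and> u \<in> pverts G \<and> v \<in> pverts G" if "e \<in> edges G" for e
    using that pair_no_loops by (force simp: edges_def dest: in_arcsD1 in_arcsD2)
qed (rule pair_finite_verts)

lemma (in pair_graph) proper_prob_edges:
  assumes "q > 0"
  shows "coloured_graph.proper_prob (pverts G) (edges G) q
    = hom_count G (complete_graph q) / real q ^ card (pverts G)"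
proof -
  interpret coloured_graph "pverts G" "edges G" q
    using assms simple_graph_edges by (simp add: coloured_graph_def coloured_graph_axioms_def)
  have "homs G (complete_graph q) = {f \<in> colourings. \<forall>e\<in>edges G. \<not> monochromatic f e}"
    by (fastforce simp: homs_def complete_graph_def colourings_def edges_def dest: in_arcsD1 in_arcsD2)
  then show ?thesis by (simp add: proper_prob_def hom_count_def)
qed

lemma (in pair_graph) is_regular_edges:
  assumes "regular d G"
  shows "simple_graph.is_regular (pverts G) (edges G) d"
proof -
  interpret S: simple_graph "pverts G" "edges G" by (rule simple_graph_edges)
  have "card (S.neighbours v) = out_degree (with_proj G) v" for v
  proof -
    have "out_arcs (with_proj G) v = Pair v ` S.neighbours v"
      by (auto simp: S.neighbours_def doubleton_in_edges)
    then show ?thesis by (simp add: out_degree_def card_image inj_on_def)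
  qed
  then show ?thesis using assms by (simp add: S.is_regular_def regular_def)
qed

text \<open>A digraph isomorphism carries its own arc map; since arcs here are pairs, its effect is
  determined by the vertex map.\<close>

lemma digraph_iso_arcs_image:
  assumes "digraph_iso (with_proj G) (with_proj H)"
  obtains \<phi> where "bij_betw \<phi> (pverts G) (pverts H)" "parcs H = map_prod \<phi> \<phi> ` parcs G"
proof -
  obtain f where f: "pre_digraph.digraph_isomorphism (with_proj G) f"
    "with_proj H = app_iso f (with_proj G)"
    using assms unfolding digraph_iso_def by blast
  interpret wf_digraph "with_proj G" using f(1) by (simp add: pre_digraph.digraph_isomorphism_def)
  have "pverts H = iso_verts f ` pverts G" using arg_cong[OF f(2), of verts] by simp
  moreover have "inj_on (iso_verts f) (pverts G)"
    using digraph_isomorphism_inj_on_verts[OF f(1)] by simp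
  moreover have "parcs H = map_prod (iso_verts f) (iso_verts f) ` parcs G"
    using arcs_ends_app_iso_eq[OF f(1)] f(2)[symmetric] by (simp add: map_prod_def)
  ultimately show ?thesis using that by (auto simp: bij_betw_def)
qed

lemma digraph_isoI:
  assumes "pair_graph G" "bij_betw \<phi> (pverts G) (pverts H)" "parcs H = map_prod \<phi> \<phi> ` parcs G"
  shows "digraph_iso (with_proj G) (with_proj H)"
proof -
  interpret pair_graph G by fact
  let ?f = "\<lparr>iso_verts = \<phi>, iso_arcs = map_prod \<phi> \<phi>, iso_head = snd, iso_tail = fst\<rparr>"
  have inj: "inj_on \<phi> (pverts G)" using assms(2) by (simp add: bij_betw_def)
  have "inj_on (map_prod \<phi> \<phi>) (pverts G \<times> pverts G)" using map_prod_inj_on[OF inj inj] .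
  then have "inj_on (map_prod \<phi> \<phi>) (parcs G)"
    by (rule inj_on_subset) (auto dest: in_arcsD1 in_arcsD2)
  then have "pre_digraph.digraph_isomorphism (with_proj G) ?f"
    using inj wf_digraph_axioms by (simp add: pre_digraph.digraph_isomorphism_def)
  moreover have "with_proj H = app_iso ?f (with_proj G)"
    using assms(2,3) by (simp add: app_iso_def with_proj_def bij_betw_def)
  ultimately show ?thesis unfolding digraph_iso_def by blast
qed

text \<open>Composition with the vertex bijection and with its inverse; the restrictions keep the
  maps extensional, as \<open>homs\<close> requires.\<close>

lemma hom_count_digraph_iso:
  assumes "pair_graph G" "digraph_iso (with_proj G) (with_proj H)"
  shows "hom_count G X = hom_count H X"
proof -
  interpret pair_graph G by fact
  obtain \<phi> where \<phi>: "bij_betw \<phi> (pverts G) (pverts H)" "parcs H = map_prod \<phi> \<phi> ` parcs G"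
    using digraph_iso_arcs_image[OF assms(2)] .
  define \<psi> where "\<psi> = inv_into (pverts G) \<phi>"
  have \<psi>: "\<psi> (\<phi> v) = v" "\<phi> v \<in> pverts H" if "v \<in> pverts G" for v
    using \<phi>(1) that by (auto simp: \<psi>_def bij_betw_def)
  have \<psi>': "\<phi> (\<psi> x) = x" "\<psi> x \<in> pverts G" if "x \<in> pverts H" for x
    using \<phi>(1) that by (auto simp: \<psi>_def bij_betw_def f_inv_into_f inv_into_into)
  have "bij_betw (\<lambda>f. restrict (f \<circ> \<phi>) (pverts G)) (homs H X) (homs G X)"
  proof (rule bij_betw_byWitness[where f' = "\<lambda>g. restrict (g \<circ> \<psi>) (pverts H)"])
    show "\<forall>f\<in>homs H X. restrict (restrict (f \<circ> \<phi>) (pverts G) \<circ> \<psi>) (pverts H) = f"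
      by (auto simp: homs_def \<psi>' restrict_def fun_eq_iff PiE_def extensional_def)
    show "\<forall>g\<in>homs G X. restrict (restrict (g \<circ> \<psi>) (pverts H) \<circ> \<phi>) (pverts G) = g"
      by (auto simp: homs_def \<psi> restrict_def fun_eq_iff PiE_def extensional_def)
    show "(\<lambda>f. restrict (f \<circ> \<phi>) (pverts G)) ` homs H X \<subseteq> homs G X"
    proof (rule image_subsetI)
      fix f assume "f \<in> homs H X"
      then have f: "f \<in> pverts H \<rightarrow>\<^sub>E pverts X" "\<And>x y. (x, y) \<in> parcs H \<Longrightarrow> (f x, f y) \<in> parcs X"
        by (simp_all add: homs_def)
      have "(f (\<phi> u), f (\<phi> v)) \<in> parcs X" if "(u, v) \<in> parcs G" for u v
        by (rule f(2)) (use that \<phi>(2) in force)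
      moreover have "f (\<phi> v) \<in> pverts X" if "v \<in> pverts G" for v
        using PiE_mem[OF f(1) \<psi>(2)[OF that]] .
      ultimately show "restrict (f \<circ> \<phi>) (pverts G) \<in> homs G X"
        by (simp add: homs_def restrict_PiE_iff in_arcsD1 in_arcsD2)
    qed
    show "(\<lambda>g. restrict (g \<circ> \<psi>) (pverts H)) ` homs G X \<subseteq> homs H X"
    proof (rule image_subsetI)
      fix g assume "g \<in> homs G X"
      then have g: "g \<in> pverts G \<rightarrow>\<^sub>E pverts X" "\<And>u v. (u, v) \<in> parcs G \<Longrightarrow> (g u, g v) \<in> parcs X"
        by (simp_all add: homs_def)
      have "x \<in> pverts H" "y \<in> pverts H" "(g (\<psi> x), g (\<psi> y)) \<in> parcs X"
        if xy: "(x, y) \<in> parcs H" for x y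
      proof -
        obtain u v where uv: "(u, v) \<in> parcs G" "x = \<phi> u" "y = \<phi> v"
          using xy unfolding \<phi>(2) by auto
        note V = in_arcsD1[OF uv(1)] in_arcsD2[OF uv(1)]
        show "x \<in> pverts H" "y \<in> pverts H" "(g (\<psi> x), g (\<psi> y)) \<in> parcs X"
          using \<psi>[OF V(1)] \<psi>[OF V(2)] g(2)[OF uv(1)] uv by simp_all
      qed
      moreover have "g (\<psi> x) \<in> pverts X" if "x \<in> pverts H" for x
        using PiE_mem[OF g(1) \<psi>'(2)[OF that]] .
      ultimately show "restrict (g \<circ> \<psi>) (pverts H) \<in> homs H X"
        by (simp add: homs_def restrict_PiE_iff)
    qed
  qed
  from bij_betw_same_card[OF this] show ?thesis by (simp add: hom_count_def)
qed

text \<open>No arc joins different copies, so currying identifies a homomorphism with an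
  \<open>m\<close>-tuple of independent homomorphisms from \<open>H\<close>.\<close>

lemma hom_count_disjoint_copies:
  assumes "pair_graph H"
  shows "hom_count (disjoint_copies m H) X = hom_count H X ^ m"
proof -
  interpret pair_graph H by fact
  have "bij_betw (\<lambda>f. \<lambda>i\<in>{..<m}. \<lambda>v\<in>pverts H. f (i, v)) (homs (disjoint_copies m H) X)
     ({..<m} \<rightarrow>\<^sub>E homs H X)" (is "bij_betw ?F ?A ?B")
  proof (rule bij_betw_byWitness[where f' = "\<lambda>g. \<lambda>(i, v)\<in>{..<m} \<times> pverts H. g i v"])
    have verts: "pverts (disjoint_copies m H) = {..<m} \<times> pverts H"
      by (simp add: disjoint_copies_def)
    have arcs: "((i, u), (j, v)) \<in> parcs (disjoint_copies m H) \<longleftrightarrow> i < m \<and> i = j \<and> (u, v) \<in> parcs H"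
      for i j u v by (auto simp: disjoint_copies_def)
    show "\<forall>f\<in>?A. (\<lambda>(i, v)\<in>{..<m} \<times> pverts H. ?F f i v) = f"
    proof
      fix f assume "f \<in> ?A"
      then have "f \<in> extensional ({..<m} \<times> pverts H)" by (simp add: homs_def verts PiE_def)
      then show "(\<lambda>(i, v)\<in>{..<m} \<times> pverts H. ?F f i v) = f"
        by (intro extensionalityI[of _ "{..<m} \<times> pverts H"]) auto
    qed
    show "\<forall>g\<in>?B. ?F (\<lambda>(i, v)\<in>{..<m} \<times> pverts H. g i v) = g"
    proof
      fix g assume g: "g \<in> ?B"
      show "?F (\<lambda>(i, v)\<in>{..<m} \<times> pverts H. g i v) = g"
      proof (rule extensionalityI[of _ "{..<m}"])
        fix i assume i: "i \<in> {..<m}"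
        then have "g i \<in> extensional (pverts H)" using PiE_mem[OF g i] by (simp add: homs_def PiE_def)
        then have "(\<lambda>v\<in>pverts H. g i v) = g i" by (rule extensional_restrict)
        moreover have "(\<lambda>v\<in>pverts H. (\<lambda>(i, v)\<in>{..<m} \<times> pverts H. g i v) (i, v)) = (\<lambda>v\<in>pverts H. g i v)"
          using i by (intro restrict_ext) simp
        ultimately show "?F (\<lambda>(i, v)\<in>{..<m} \<times> pverts H. g i v) i = g i" using i by simp
      qed (use g in \<open>auto simp: PiE_def\<close>)
    qed
    show "?F ` ?A \<subseteq> ?B"
    proof (rule image_subsetI)
      fix f assume "f \<in> ?A"
      then have f: "\<And>i v. i < m \<Longrightarrow> v \<in> pverts H \<Longrightarrow> f (i, v) \<in> pverts X"
        "\<And>i u v. i < m \<Longrightarrow> (u, v) \<in> parcs H \<Longrightarrow> (f (i, u), f (i, v)) \<in> parcs X"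
        using arcs by (auto simp: homs_def verts PiE_iff)
      then show "?F f \<in> ?B"
        by (simp add: restrict_PiE_iff homs_def in_arcsD1 in_arcsD2)
    qed
    show "(\<lambda>g. \<lambda>(i, v)\<in>{..<m} \<times> pverts H. g i v) ` ?B \<subseteq> ?A"
    proof (rule image_subsetI)
      fix g assume "g \<in> ?B"
      then have g: "g i \<in> homs H X" if "i < m" for i using that by auto
      have 1: "g i v \<in> pverts X" if "i < m" "v \<in> pverts H" for i v
        using g[OF that(1)] that(2) by (auto simp: homs_def)
      have 2: "(g i u, g i v) \<in> parcs X" if "i < m" "(u, v) \<in> parcs H" for i u v
        using g[OF that(1)] that(2) by (auto simp: homs_def)
      show "(\<lambda>(i, v)\<in>{..<m} \<times> pverts H. g i v) \<in> ?A"
        using 1 2 by (auto simp: homs_def verts arcs restrict_PiE_iff dest: in_arcsD1 in_arcsD2)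
    qed
  qed
  from bij_betw_same_card[OF this] show ?thesis by (simp add: hom_count_def card_PiE)
qed

section \<open>The extremal graph in coordinates, and the final comparison\<close>

lemma pair_graph_complete_bipartite_graph: "pair_graph (complete_bipartite_graph a b)"
proof
  have "parcs (complete_bipartite_graph a b) \<subseteq>
    ({..<a} <+> {..<b}) \<times> ({..<a} <+> {..<b})"
    by (auto simp: complete_bipartite_graph_def)
  then show "finite (parcs (complete_bipartite_graph a b))"
    by (rule finite_subset) simp
qed (auto simp: complete_bipartite_graph_def symmetric_def intro!: symI)

lemma parcs_copies_complete_bipartite:
  "parcs (disjoint_copies k (complete_bipartite_graph d d)) =
    {(x, y). x \<in> {..<k} \<times> ({..<d} <+> {..<d}) \<and> y \<in> {..<k} \<times> ({..<d} <+> {..<d}) \<and>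
      fst x = fst y \<and> isl (snd x) \<noteq> isl (snd y)}"
  by (auto simp: disjoint_copies_def complete_bipartite_graph_def)

lemma pverts_copies_complete_bipartite:
  "pverts (disjoint_copies k (complete_bipartite_graph d d)) = {..<k} \<times> ({..<d} <+> {..<d})"
  by (simp add: disjoint_copies_def complete_bipartite_graph_def)

lemma regular_copies_complete_bipartite:
  "regular d (disjoint_copies k (complete_bipartite_graph d d))"
  unfolding regular_def
proof
  let ?K = "disjoint_copies k (complete_bipartite_graph d d)"
  fix x assume "x \<in> pverts ?K"
  then obtain i y where x: "x = (i, y)" "i < k" "y \<in> {..<d} <+> {..<d}"
    by (auto simp: pverts_copies_complete_bipartite)
  have "out_arcs (with_proj ?K) x = (\<lambda>a. (x, (i, (if isl y then Inr a else Inl a)))) ` {..<d}"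
    using x by (auto simp: parcs_copies_complete_bipartite)
  moreover have "inj_on (\<lambda>a. (x, (i, (if isl y then Inr a else Inl a)))) {..<d}"
    by (auto simp: inj_on_def)
  ultimately show "out_degree (with_proj ?K) x = d"
    by (simp add: out_degree_def card_image)
qed

theorem theorem1p2:
  fixes n d q :: nat and G :: "'a pair_pre_digraph"
  assumes "d \<ge> 1"
    and "2 * d dvd n"
    and "pair_graph G"
    and "card (pverts G) = n"
    and "regular d G"
    and "q > 2 * ((n * d div 2) choose 4)"
  shows "hom_count G (complete_graph q)
           \<le> hom_count (complete_bipartite_graph d d) (complete_graph q) ^ (n div (2 * d))
       \<and> (hom_count G (complete_graph q)
             = hom_count (complete_bipartite_graph d d) (complete_graph q) ^ (n div (2 * d))
           \<longleftrightarrow> digraph_iso (with_proj G)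
                 (with_proj (disjoint_copies (n div (2 * d)) (complete_bipartite_graph d d))))"
proof -
  define k where "k = n div (2 * d)"
  have n: "n = 2 * d * k" using assms(2) by (simp add: k_def)
  define K where "K = disjoint_copies k (complete_bipartite_graph d d)"
  interpret G: pair_graph G by fact
  interpret K: pair_graph K
    unfolding K_def by (intro pair_graph_disjoint_copies pair_graph_complete_bipartite_graph)
  interpret GS: simple_graph "pverts G" "edges G" by (rule G.simple_graph_edges)
  interpret KS: simple_graph "pverts K" "edges K" by (rule K.simple_graph_edges)
  have hom_K: "hom_count K X = hom_count (complete_bipartite_graph d d) X ^ k" for X :: "'b pair_pre_digraph"
    unfolding K_def by (rule hom_count_disjoint_copies[OF pair_graph_complete_bipartite_graph])
  have arcs_K: "(x, y) \<in> parcs K \<longleftrightarrow> x \<in> pverts K \<and> y \<in> pverts K \<and> fst x = fst y \<and> isl (snd x) \<noteq> isl (snd y)" for x y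
    unfolding K_def by (simp add: parcs_copies_complete_bipartite pverts_copies_complete_bipartite)
  have card_K: "card (pverts K) = n"
    by (simp add: K_def pverts_copies_complete_bipartite card_cartesian_product card_Plus n)
  have reg_G: "GS.is_regular d" and reg_K: "KS.is_regular d"
    using G.is_regular_edges[OF assms(5)] K.is_regular_edges regular_copies_complete_bipartite[of d k]
    by (simp_all add: K_def)
  \<comment> \<open>Each step of a walk stays in its copy and changes sides, so after three steps
    the ends lie on opposite sides of the same copy.\<close>
  have full_K: "KS.full"
    unfolding KS.full_def K.doubleton_in_edges arcs_K by auto
  have iso: "digraph_iso (with_proj G) (with_proj K)" if full: "GS.full"
  proof -
    have "\<forall>u\<in>pverts G. GS.neighbours u \<subseteq> pverts G"
      by (auto simp: GS.neighbours_def dest: GS.edge_in_V)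
    then obtain \<phi> where \<phi>: "bij_betw \<phi> (pverts G) ({..<k} \<times> ({..<d} <+> {..<d}))"
      "\<forall>u\<in>pverts G. \<forall>v\<in>pverts G. {u, v} \<in> edges G \<longleftrightarrow>
        fst (\<phi> u) = fst (\<phi> v) \<and> isl (snd (\<phi> u)) \<noteq> isl (snd (\<phi> v))"
      using GS.full_closed_decomposition[OF full reg_G assms(1), of "pverts G" k] assms(4) n
      by auto
    have bij: "bij_betw \<phi> (pverts G) (pverts K)"
      using \<phi>(1) by (simp add: K_def pverts_copies_complete_bipartite)
    have iff: "(u, v) \<in> parcs G \<longleftrightarrow> (\<phi> u, \<phi> v) \<in> parcs K" if "u \<in> pverts G" "v \<in> pverts G" for u v
      using \<phi>(2) that bij_betw_apply[OF bij] by (simp add: arcs_K flip: G.doubleton_in_edges)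
    have "parcs K = map_prod \<phi> \<phi> ` parcs G"
    proof (intro equalityI subrelI)
      fix x y assume xy: "(x, y) \<in> parcs K"
      then have "x \<in> \<phi> ` pverts G" "y \<in> \<phi> ` pverts G"
        using K.in_arcsD1[OF xy] K.in_arcsD2[OF xy] bij by (simp_all add: bij_betw_def)
      then obtain u v where uv: "u \<in> pverts G" "v \<in> pverts G" "x = \<phi> u" "y = \<phi> v" by blast
      with xy iff have "(u, v) \<in> parcs G" by blast
      with uv show "(x, y) \<in> map_prod \<phi> \<phi> ` parcs G" by force
    next
      fix x y assume "(x, y) \<in> map_prod \<phi> \<phi> ` parcs G"
      then obtain u v where "(u, v) \<in> parcs G" "x = \<phi> u" "y = \<phi> v" by auto
      with iff show "(x, y) \<in> parcs K" using G.in_arcsD1 G.in_arcsD2 by blast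
    qed
    with bij show ?thesis by (intro digraph_isoI assms(3))
  qed
  have less: "hom_count G (complete_graph q) < hom_count K (complete_graph q)" if not_full: "\<not> GS.full"
  proof -
    have "d \<noteq> 1" using GS.regular_1_full reg_G not_full by blast
    then have d: "d \<ge> 2" using assms(1) by simp
    have m: "2 * card (edges G) = n * d" using GS.card_edges[OF reg_G] assms(4) by simp
    \<comment> \<open>The empty graph is full, so here an edge exists and there is at least one copy
      to compare with; this yields the lower bound on the number of edges.\<close>
    have "edges G \<noteq> {}" using not_full by (auto simp: GS.full_def)
    then have "k \<noteq> 0" using m GS.finite_E n by (auto simp: card_eq_0_iff)
    moreover have "card (edges G) = d\<^sup>2 * k" using m n by (simp add: power2_eq_square)
    ultimately have m_ge: "card (edges G) \<ge> d\<^sup>2" by simp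
    have q: "q > 2 * (card (edges G) choose 4)" using assms(6) m[symmetric] by simp
    then have "q > 0" by simp
    have "coloured_graph (pverts G) (edges G) q" "coloured_graph (pverts K) (edges K) q"
      using \<open>q > 0\<close> GS.simple_graph_axioms KS.simple_graph_axioms
      by (simp_all add: coloured_graph_def coloured_graph_axioms_def)
    from proper_prob_less_full[OF this _ reg_G reg_K not_full full_K d m_ge q]
    have "coloured_graph.proper_prob (pverts G) (edges G) q < coloured_graph.proper_prob (pverts K) (edges K) q"
      using assms(4) card_K by simp
    then show ?thesis
      using \<open>q > 0\<close> assms(4) card_K
      by (simp add: G.proper_prob_edges K.proper_prob_edges divide_less_cancel)
  qed
  have eq: "hom_count G (complete_graph q) = hom_count K (complete_graph q)"
    if "digraph_iso (with_proj G) (with_proj K)"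
    using hom_count_digraph_iso[OF assms(3) that] .
  \<comment> \<open>A full \<open>G\<close> is isomorphic to \<open>K\<close> and attains equality;
    otherwise the inequality is strict, which also rules out an isomorphism.\<close>
  have "hom_count G (complete_graph q) \<le> hom_count K (complete_graph q) \<and>
    (hom_count G (complete_graph q) = hom_count K (complete_graph q) \<longleftrightarrow>
      digraph_iso (with_proj G) (with_proj K))"
    using iso less eq by (cases "GS.full") auto
  then show ?thesis unfolding hom_K unfolding K_def k_def .
qed

end
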